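(* Let $\tilde{\mathfrak K}$ be a Hilbert space and $\tilde A,\tilde B$ bounded doubly infinite Toeplitz operators on $L^2(\tilde{\mathfrak K})$ (not necessarily of finite degree), and suppose the set $\tilde{\mathcal M}=\{M:\begin{pmatrix}\tilde A-M&\tilde B^*\\\tilde B&M\end{pmatrix}\ge0\}$ is not empty. Then there exists a doubly infinite Toeplitz operator $\hat A\le\tilde A$ such that $\hat{\mathcal M}=\{M:\begin{pmatrix}\hat A-M&\tilde B^*\\\tilde B&M\end{pmatrix}\ge0\}=\{\hat M\}$ is a singleton. In this case $\hat M$ is a bounded doubly infinite Toeplitz operator.
   Context: $L^2(\tilde{\mathfrak K})=\bigoplus_{-\infty}^{\infty}\tilde{\mathfrak K}$; a doubly infinite Toeplitz operator is a bounded operator on it with block matrix entries $X_{j,k}=X_{j-k}$ (equivalently commuting with the bilateral shift). $M$ ranges over bounded operators on $L^2(\tilde{\mathfrak K})$; "$\ge0$" means positive semidefinite. *)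

theory Defs
  imports "HOL-Analysis.Analysis"
begin

text \<open>A complex Hilbert space is modelled by a carrier type 'k (an abelian group),
  a complex scalar multiplication sc and an inner product ip, linear in the first
  argument and conjugate-linear in the second.\<close>

definition hnorm :: "('k \<Rightarrow> 'k \<Rightarrow> complex) \<Rightarrow> 'k \<Rightarrow> real" where
  "hnorm ip x = sqrt (Re (ip x x))"

definition complex_hilbert ::
  "(complex \<Rightarrow> 'k::ab_group_add \<Rightarrow> 'k) \<Rightarrow> ('k \<Rightarrow> 'k \<Rightarrow> complex) \<Rightarrow> bool" where
  "complex_hilbert sc ip \<longleftrightarrow>
     (\<forall>x. sc 1 x = x) \<and>
     (\<forall>a b x. sc a (sc b x) = sc (a * b) x) \<and>
     (\<forall>a b x. sc (a + b) x = sc a x + sc b x) \<and>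
     (\<forall>a x y. sc a (x + y) = sc a x + sc a y) \<and>
     (\<forall>x y z. ip (x + y) z = ip x z + ip y z) \<and>
     (\<forall>a x y. ip (sc a x) y = a * ip x y) \<and>
     (\<forall>x y. ip y x = cnj (ip x y)) \<and>
     (\<forall>x. Im (ip x x) = 0 \<and> Re (ip x x) \<ge> 0) \<and>
     (\<forall>x. ip x x = 0 \<longrightarrow> x = 0) \<and>
     (\<forall>X :: nat \<Rightarrow> 'k.
        (\<forall>e>0. \<exists>N. \<forall>m\<ge>N. \<forall>n\<ge>N. hnorm ip (X m - X n) < e) \<longrightarrow>
        (\<exists>l. (\<lambda>n. hnorm ip (X n - l)) \<longlonglongrightarrow> 0))"

definition L2 :: "('k \<Rightarrow> 'k \<Rightarrow> complex) \<Rightarrow> (int \<Rightarrow> 'k) set" where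
  "L2 ip = {f. (\<lambda>n. (hnorm ip (f n))\<^sup>2) summable_on UNIV}"

definition l2ip :: "('k \<Rightarrow> 'k \<Rightarrow> complex) \<Rightarrow> (int \<Rightarrow> 'k) \<Rightarrow> (int \<Rightarrow> 'k) \<Rightarrow> complex" where
  "l2ip ip f g = (\<Sum>\<^sub>\<infinity>n. ip (f n) (g n))"

definition l2norm :: "('k \<Rightarrow> 'k \<Rightarrow> complex) \<Rightarrow> (int \<Rightarrow> 'k) \<Rightarrow> real" where
  "l2norm ip f = sqrt (\<Sum>\<^sub>\<infinity>n. (hnorm ip (f n))\<^sup>2)"

text \<open>Bounded (linear) operators on L^2(K); only their values on L^2(K) matter.\<close>

definition bounded_op ::
  "(complex \<Rightarrow> 'k::ab_group_add \<Rightarrow> 'k) \<Rightarrow> ('k \<Rightarrow> 'k \<Rightarrow> complex)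
    \<Rightarrow> ((int \<Rightarrow> 'k) \<Rightarrow> (int \<Rightarrow> 'k)) \<Rightarrow> bool" where
  "bounded_op sc ip T \<longleftrightarrow>
     (\<forall>f\<in>L2 ip. T f \<in> L2 ip) \<and>
     (\<forall>f\<in>L2 ip. \<forall>g\<in>L2 ip. T (\<lambda>n. f n + g n) = (\<lambda>n. T f n + T g n)) \<and>
     (\<forall>a. \<forall>f\<in>L2 ip. T (\<lambda>n. sc a (f n)) = (\<lambda>n. sc a (T f n))) \<and>
     (\<exists>C. \<forall>f\<in>L2 ip. l2norm ip (T f) \<le> C * l2norm ip f)"

definition l2adj ::
  "(complex \<Rightarrow> 'k::ab_group_add \<Rightarrow> 'k) \<Rightarrow> ('k \<Rightarrow> 'k \<Rightarrow> complex)
    \<Rightarrow> ((int \<Rightarrow> 'k) \<Rightarrow> (int \<Rightarrow> 'k)) \<Rightarrow> ((int \<Rightarrow> 'k) \<Rightarrow> (int \<Rightarrow> 'k))" where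
  "l2adj sc ip T = (SOME T'. bounded_op sc ip T' \<and>
      (\<forall>f\<in>L2 ip. \<forall>g\<in>L2 ip. l2ip ip (T f) g = l2ip ip f (T' g)))"

text \<open>The sequence with x at position k and 0 elsewhere; the block matrix entry
  X_{j,k} of T is x \<mapsto> T (delta k x) j.\<close>

definition delta :: "int \<Rightarrow> 'k::zero \<Rightarrow> int \<Rightarrow> 'k" where
  "delta k x = (\<lambda>j. if j = k then x else 0)"

definition toeplitz ::
  "(complex \<Rightarrow> 'k::ab_group_add \<Rightarrow> 'k) \<Rightarrow> ('k \<Rightarrow> 'k \<Rightarrow> complex)
    \<Rightarrow> ((int \<Rightarrow> 'k) \<Rightarrow> (int \<Rightarrow> 'k)) \<Rightarrow> bool" where
  "toeplitz sc ip T \<longleftrightarrow> bounded_op sc ip T \<and>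
     (\<forall>j k x. T (delta k x) j = T (delta (k + 1) x) (j + 1))"

definition op_psd :: "('k \<Rightarrow> 'k \<Rightarrow> complex) \<Rightarrow> ((int \<Rightarrow> 'k) \<Rightarrow> (int \<Rightarrow> 'k)) \<Rightarrow> bool" where
  "op_psd ip T \<longleftrightarrow> (\<forall>x\<in>L2 ip. Im (l2ip ip (T x) x) = 0 \<and> Re (l2ip ip (T x) x) \<ge> 0)"

definition block_psd ::
  "('k::ab_group_add \<Rightarrow> 'k \<Rightarrow> complex)
    \<Rightarrow> ((int \<Rightarrow> 'k) \<Rightarrow> (int \<Rightarrow> 'k)) \<Rightarrow> ((int \<Rightarrow> 'k) \<Rightarrow> (int \<Rightarrow> 'k))
    \<Rightarrow> ((int \<Rightarrow> 'k) \<Rightarrow> (int \<Rightarrow> 'k)) \<Rightarrow> ((int \<Rightarrow> 'k) \<Rightarrow> (int \<Rightarrow> 'k)) \<Rightarrow> bool" where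
  "block_psd ip P Q R S \<longleftrightarrow>
     (\<forall>x\<in>L2 ip. \<forall>y\<in>L2 ip.
        Im (l2ip ip (\<lambda>n. P x n + Q y n) x + l2ip ip (\<lambda>n. R x n + S y n) y) = 0 \<and>
        Re (l2ip ip (\<lambda>n. P x n + Q y n) x + l2ip ip (\<lambda>n. R x n + S y n) y) \<ge> 0)"

definition Mset ::
  "(complex \<Rightarrow> 'k::ab_group_add \<Rightarrow> 'k) \<Rightarrow> ('k \<Rightarrow> 'k \<Rightarrow> complex)
    \<Rightarrow> ((int \<Rightarrow> 'k) \<Rightarrow> (int \<Rightarrow> 'k)) \<Rightarrow> ((int \<Rightarrow> 'k) \<Rightarrow> (int \<Rightarrow> 'k))
    \<Rightarrow> ((int \<Rightarrow> 'k) \<Rightarrow> (int \<Rightarrow> 'k)) set" where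
  "Mset sc ip A B = {M. bounded_op sc ip M \<and>
      block_psd ip (\<lambda>x n. A x n - M x n) (l2adj sc ip B) B M}"

end

(*
Everything is phrased through quadratic forms: M is feasible for A when
<Ax,x> - <Mx,x> + 2 Re <Bx,y> + <My,y> >= 0 for all x and y, and Toeplitz operators correspond to
forms invariant under the bilateral shift.

Feasible forms have a largest and a smallest element; these are canonical, hence shift invariant.
By Zorn's lemma there is a minimal Toeplitz form Ahat <= A that still admits a feasible form.
Let m be the midpoint of the largest and the smallest feasible form of Ahat.  The Schur complement
of its block form onto the first coordinate is shift invariant and may be subtracted from Ahat, so
it vanishes by minimality.  Hence for each x some y nearly annihilates the block forms of both
extremes, and Cauchy--Schwarz forces the two extremes to agree at x.
*)

theory Submission
  imports Defs "HOL-Library.Function_Algebras"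
begin

section \<open>Invariant quadratic forms\<close>

text \<open>Forms are preferred to operators because the infima that occur become pointwise infima
  of real numbers, and inverses become infima over the second coordinate. Operators return only at
  the end, by polarization and Riesz representation, where
  \<open>0 \<le> m \<le> \<alpha> \<le> a\<close> supplies the bounds. The largest feasible form
  alone would not do in the last step: it is a fixed point of \<open>schur a\<close>, so the Schur
  complement of its own block form vanishes whatever \<open>a\<close> is. The midpoint is
  informative because its block form is the average of two nonnegative ones, so a single y is nearly
  null for both extremes at once. Minimality holds among invariant forms only, so the Schur
  complement that is subtracted must itself be invariant; the invariance of both extremes serves
  this purpose. The obstacle in Zorn's lemma is that the infimum of a chain must still admit a
  feasible form. Feasible forms picked arbitrarily along the chain need not be monotone, but the
  largest ones are.\<close>

lemma quadratic_nonneg_discrim: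
  fixes p q r :: real
  assumes "\<And>t. 0 \<le> q + 2 * t * r + t\<^sup>2 * p"
  shows "r\<^sup>2 \<le> q * p"
proof (cases "p = 0")
  case True
  have "r = 0"
  proof (rule ccontr)
    assume "r \<noteq> 0"
    \<comment> \<open>This t makes the affine function of t equal to -1.\<close>
    then show False
      using assms[of "- (q + 1) / (2 * r)"] True by (simp add: field_simps)
  qed
  then show ?thesis using True by simp
next
  case False
  have p: "0 < p"
  proof (rule ccontr)
    assume "\<not> 0 < p"
    with False have neg: "p < 0" by simp
    \<comment> \<open>The quotient gives
      \<open>t * (- p) \<ge> \<bar>q\<bar> + 2 * \<bar>r\<bar> + 1\<close> and the summand 1 gives
      \<open>1 \<le> t\<close>. Multiplying the former by t makes the quadratic term outweigh the
      other two by at least t.\<close>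
    define t where "t = (\<bar>q\<bar> + 2 * \<bar>r\<bar> + 1) / (- p) + 1"
    have t1: "1 \<le> t" unfolding t_def using neg by (simp add: divide_nonneg_nonpos)
    have tp: "t * (- p) \<ge> \<bar>q\<bar> + 2 * \<bar>r\<bar> + 1"
      using neg unfolding t_def by (simp add: field_simps)
    have "t * (\<bar>q\<bar> + 2 * \<bar>r\<bar> + 1) \<le> t * (t * (- p))"
      using tp t1 by (intro mult_left_mono) auto
    moreover have "q \<le> t * \<bar>q\<bar>" using t1 mult_right_mono[of 1 t "\<bar>q\<bar>"] by auto
    moreover have "2 * t * r \<le> 2 * t * \<bar>r\<bar>" using t1 by simp
    ultimately have "q + 2 * t * r + t\<^sup>2 * p \<le> - t"
      by (simp add: algebra_simps power2_eq_square)
    then show False using assms[of t] t1 by linarith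
  qed
  have "0 \<le> q + 2 * (- r / p) * r + (- r / p)\<^sup>2 * p" by (rule assms)
  also have "\<dots> = q - r\<^sup>2 / p" using p by (simp add: field_simps power2_eq_square)
  finally show ?thesis using p by (simp add: field_simps)
qed

text \<open>The vectors form a set inside a type because the square-summable sequences are a proper
  part of the type of all sequences in general. The scalar laws hold on the whole type; only closure
  refers to \<open>H\<close>.\<close>

locale csubspace =
  fixes H :: "'h::ab_group_add set" and sc :: "complex \<Rightarrow> 'h \<Rightarrow> 'h"
  assumes zero_closed [simp]: "0 \<in> H"
    and add_closed [simp]: "x \<in> H \<Longrightarrow> y \<in> H \<Longrightarrow> x + y \<in> H"
    and sc_closed [simp]: "x \<in> H \<Longrightarrow> sc c x \<in> H"
    and sc_one [simp]: "sc 1 x = x"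
    and sc_sc [simp]: "sc c (sc d x) = sc (c * d) x"
    and sc_add_left: "sc (c + d) x = sc c x + sc d x"
    and sc_add_right: "sc c (x + y) = sc c x + sc c y"
begin

lemma sc_zero_left [simp]: "sc 0 x = 0"
  using sc_add_left[of 0 0 x] by simp

lemma sc_zero_right [simp]: "sc c 0 = 0"
  using sc_add_right[of c 0 0] by simp

lemma sc_minus_one: "sc (- 1) x = - x"
  using sc_add_left[of 1 "- 1" x] by (simp add: eq_neg_iff_add_eq_0 add.commute)

lemma uminus_closed [simp]: "x \<in> H \<Longrightarrow> - x \<in> H"
  using sc_closed[of x "- 1"] by (simp add: sc_minus_one)

lemma diff_closed [simp]: "x \<in> H \<Longrightarrow> y \<in> H \<Longrightarrow> x - y \<in> H"
  using add_closed[of x "- y"] by simp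

lemma sc_uminus_right: "sc c (- x) = - sc c x"
  using sc_add_right[of c x "- x"] by (simp add: eq_neg_iff_add_eq_0 add.commute)

lemma sc_uminus_left: "sc (- c) x = - sc c x"
  using sc_add_left[of c "- c" x] by (simp add: eq_neg_iff_add_eq_0 add.commute)

lemma sc_diff_right: "sc c (x - y) = sc c x - sc c y"
  using sc_add_right[of c x "- y"] by (simp add: sc_uminus_right)

lemma sc_two: "sc 2 x = x + x"
  using sc_add_left[of 1 1 x] by simp

text \<open>The parallelogram law and homogeneity mention only values of \<open>q\<close>, so they
  survive pointwise infima; the sesquilinear form behind \<open>q\<close> is recovered later by
  polarization.\<close>

definition qform :: "('h \<Rightarrow> real) \<Rightarrow> bool" where
  "qform q \<longleftrightarrow> (\<forall>x\<in>H. \<forall>y\<in>H. q (x + y) + q (x - y) = 2 * q x + 2 * q y) \<and>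
     (\<forall>c. \<forall>x\<in>H. q (sc c x) = (cmod c)\<^sup>2 * q x)"

lemma qform_parallelogram:
  "qform q \<Longrightarrow> x \<in> H \<Longrightarrow> y \<in> H \<Longrightarrow> q (x + y) + q (x - y) = 2 * q x + 2 * q y"
  by (simp add: qform_def)

lemma qform_sc: "qform q \<Longrightarrow> x \<in> H \<Longrightarrow> q (sc c x) = (cmod c)\<^sup>2 * q x"
  by (simp add: qform_def)

lemma qform_zero: "qform q \<Longrightarrow> q 0 = 0"
  using qform_sc[of q 0 0] by simp

lemma qform_uminus: "qform q \<Longrightarrow> x \<in> H \<Longrightarrow> q (- x) = q x"
  using qform_sc[of q x "- 1"] by (simp add: sc_minus_one)

lemma qform_add: "qform p \<Longrightarrow> qform q \<Longrightarrow> qform (\<lambda>x. p x + q x)"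
  unfolding qform_def by (simp add: algebra_simps)

lemma qform_diff: "qform p \<Longrightarrow> qform q \<Longrightarrow> qform (\<lambda>x. p x - q x)"
  unfolding qform_def by (simp add: algebra_simps)

lemma qform_scale: "qform p \<Longrightarrow> qform (\<lambda>x. r * p x)"
  unfolding qform_def by (simp add: algebra_simps) (metis distrib_left)

lemma qform_cong: "qform p \<Longrightarrow> (\<And>x. x \<in> H \<Longrightarrow> q x = p x) \<Longrightarrow> qform q"
  unfolding qform_def by simp

text \<open>Subadditive versions of the axioms suffice: the reverse inequalities arise from
  the substitutions \<open>x \<mapsto> c\<inverse> x\<close> and \<open>(x, y) \<mapsto> (x + y, x - y)\<close>.\<close>

lemma qform_infimum:
  assumes ne: "I \<noteq> {}"
    and nonneg: "\<And>i x. i \<in> I \<Longrightarrow> x \<in> H \<Longrightarrow> 0 \<le> g i x"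
    and par: "\<And>i j x y. i \<in> I \<Longrightarrow> j \<in> I \<Longrightarrow> x \<in> H \<Longrightarrow> y \<in> H \<Longrightarrow>
        \<exists>k\<in>I. \<exists>l\<in>I. g k (x + y) + g l (x - y) \<le> 2 * g i x + 2 * g j y"
    and hom: "\<And>i c x. i \<in> I \<Longrightarrow> x \<in> H \<Longrightarrow> \<exists>k\<in>I. g k (sc c x) \<le> (cmod c)\<^sup>2 * g i x"
    and f: "\<And>x. x \<in> H \<Longrightarrow> f x = (INF i\<in>I. g i x)"
  shows "qform f"
proof -
  have f_le: "f x \<le> g i x" if "i \<in> I" "x \<in> H" for i x
    unfolding f[OF that(2)] using that nonneg
    by (intro cINF_lower bdd_belowI2[where m=0]) auto
  have f_ge: "t \<le> f x" if "x \<in> H" "\<And>i. i \<in> I \<Longrightarrow> t \<le> g i x" for t x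
    unfolding f[OF that(1)] using that ne by (intro cINF_greatest) auto
  have f_nonneg: "0 \<le> f x" if "x \<in> H" for x using that nonneg by (intro f_ge) auto
  have sub: "f (x + y) + f (x - y) \<le> 2 * f x + 2 * f y" if x: "x \<in> H" and y: "y \<in> H" for x y
  proof -
    have 1: "f (x + y) + f (x - y) \<le> 2 * g i x + 2 * g j y" if ij: "i \<in> I" "j \<in> I" for i j
    proof -
      obtain k l where "k \<in> I" "l \<in> I" "g k (x + y) + g l (x - y) \<le> 2 * g i x + 2 * g j y"
        using par[OF ij x y] by blast
      then show ?thesis using f_le[of k "x + y"] f_le[of l "x - y"] x y by simp
    qed
    \<comment> \<open>The indices \<open>i\<close> and \<open>j\<close> vary independently, so the
      infimum can be taken over one after the other.\<close>
    have 2: "(f (x + y) + f (x - y) - 2 * g j y) / 2 \<le> f x" if "j \<in> I" for j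
      using 1[OF _ that] x by (intro f_ge) (auto simp: field_simps)
    have "(f (x + y) + f (x - y) - 2 * f x) / 2 \<le> f y"
      using 2 y by (intro f_ge) (auto simp: field_simps)
    then show ?thesis by simp
  qed
  have hle: "f (sc c x) \<le> (cmod c)\<^sup>2 * f x" if x: "x \<in> H" for c x
  proof (cases "c = 0")
    case True
    obtain i where i: "i \<in> I" using ne by blast
    obtain k where "k \<in> I" "g k (sc c x) \<le> (cmod c)\<^sup>2 * g i x" using hom[OF i x] by blast
    then show ?thesis using f_le[of k "sc c x"] x True by simp
  next
    case False
    have "f (sc c x) / (cmod c)\<^sup>2 \<le> f x"
    proof (rule f_ge[OF x])
      fix i assume i: "i \<in> I"
      obtain k where "k \<in> I" "g k (sc c x) \<le> (cmod c)\<^sup>2 * g i x" using hom[OF i x] by blast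
      then show "f (sc c x) / (cmod c)\<^sup>2 \<le> g i x"
        using f_le[of k "sc c x"] x False by (simp add: field_simps)
    qed
    then show ?thesis using False by (simp add: field_simps)
  qed
  have heq: "f (sc c x) = (cmod c)\<^sup>2 * f x" if x: "x \<in> H" for c x
  proof (cases "c = 0")
    case True
    then show ?thesis using hle[OF x, of c] f_nonneg[of "sc c x"] x by simp
  next
    case False
    have "f x \<le> (cmod (inverse c))\<^sup>2 * f (sc c x)"
      using hle[of "sc c x" "inverse c"] x False by simp
    then have "(cmod c)\<^sup>2 * f x \<le> f (sc c x)"
      using False by (simp add: norm_inverse power_inverse del: inverse_eq_divide) (simp add: field_simps)
    then show ?thesis using hle[OF x, of c] by simp
  qed
  have "f (x + y) + f (x - y) = 2 * f x + 2 * f y" if x: "x \<in> H" and y: "y \<in> H" for x y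
  proof -
    have "f ((x + y) + (x - y)) + f ((x + y) - (x - y)) \<le> 2 * f (x + y) + 2 * f (x - y)"
      using x y by (intro sub) auto
    moreover have "(x + y) + (x - y) = sc 2 x" "(x + y) - (x - y) = sc 2 y"
      by (simp_all add: sc_two)
    ultimately show ?thesis using sub[OF x y] heq[OF x, of 2] heq[OF y, of 2] by simp
  qed
  then show ?thesis using heq by (simp add: qform_def)
qed

text \<open>Of two comparable forms the smaller one serves as both witnesses in the subadditive
  parallelogram inequality.\<close>

lemma qform_chain_infimum:
  assumes ne: "I \<noteq> {}" and q: "\<And>i. i \<in> I \<Longrightarrow> qform (g i)"
    and nonneg: "\<And>i x. i \<in> I \<Longrightarrow> x \<in> H \<Longrightarrow> 0 \<le> g i x"
    and chain: "\<And>i j. i \<in> I \<Longrightarrow> j \<in> I \<Longrightarrow>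
       (\<forall>x\<in>H. g i x \<le> g j x) \<or> (\<forall>x\<in>H. g j x \<le> g i x)"
    and f: "\<And>x. x \<in> H \<Longrightarrow> f x = (INF i\<in>I. g i x)"
  shows "qform f"
proof (rule qform_infimum[OF ne nonneg _ _ f])
  fix i j x y assume ij: "i \<in> I" "j \<in> I" and xy: "x \<in> H" "y \<in> H"
  from chain[OF ij] consider "\<forall>x\<in>H. g i x \<le> g j x" | "\<forall>x\<in>H. g j x \<le> g i x" by blast
  then show "\<exists>k\<in>I. \<exists>l\<in>I. g k (x + y) + g l (x - y) \<le> 2 * g i x + 2 * g j y"
  proof cases
    case 1
    then show ?thesis using qform_parallelogram[OF q[OF ij(1)] xy] xy ij
      by (intro bexI[of _ i]) auto
  next
    case 2
    then show ?thesis using qform_parallelogram[OF q[OF ij(2)] xy] xy ij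
      by (intro bexI[of _ j]) auto
  qed
next
  fix i c x assume "i \<in> I" "x \<in> H"
  then show "\<exists>k\<in>I. g k (sc c x) \<le> (cmod c)\<^sup>2 * g i x"
    using qform_sc[OF q] by (intro bexI[of _ i]) auto
qed auto

end

text \<open>The form \<open>b\<close> stands for \<open>Re \<langle>B x, y\<rangle>\<close> and \<open>U\<close> for the bilateral shift; forms that are
  invariant under \<open>U\<close> correspond to Toeplitz operators.\<close>

locale coupling = csubspace H sc for H :: "'h::ab_group_add set" and sc +
  fixes U :: "'h \<Rightarrow> 'h" and b :: "'h \<Rightarrow> 'h \<Rightarrow> real"
  assumes U_image: "U ` H = H"
    and b_add_left: "\<And>x x' y. x \<in> H \<Longrightarrow> x' \<in> H \<Longrightarrow> y \<in> H \<Longrightarrow> b (x + x') y = b x y + b x' y"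
    and b_add_right: "\<And>x y y'. x \<in> H \<Longrightarrow> y \<in> H \<Longrightarrow> y' \<in> H \<Longrightarrow> b x (y + y') = b x y + b x y'"
    and b_sc: "\<And>c x y. x \<in> H \<Longrightarrow> y \<in> H \<Longrightarrow> b (sc c x) (sc c y) = (cmod c)\<^sup>2 * b x y"
    and b_real_left: "\<And>r x y. x \<in> H \<Longrightarrow> y \<in> H \<Longrightarrow> b (sc (complex_of_real r) x) y = r * b x y"
    and b_real_right: "\<And>r x y. x \<in> H \<Longrightarrow> y \<in> H \<Longrightarrow> b x (sc (complex_of_real r) y) = r * b x y"
    and b_U: "\<And>x y. x \<in> H \<Longrightarrow> y \<in> H \<Longrightarrow> b (U x) (U y) = b x y"
begin

lemma swapped: "coupling H sc U (\<lambda>x y. b y x)"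
  by unfold_locales (simp_all add: U_image b_add_left b_add_right b_sc b_real_left b_real_right b_U)

lemma U_closed [simp]: "x \<in> H \<Longrightarrow> U x \<in> H"
  using U_image by blast

lemma b_zero_right: "x \<in> H \<Longrightarrow> b x 0 = 0"
  using b_real_right[of x 0 0] by simp

lemma b_diff_left: "x \<in> H \<Longrightarrow> x' \<in> H \<Longrightarrow> y \<in> H \<Longrightarrow> b (x - x') y = b x y - b x' y"
  using b_add_left[of "x - x'" x' y] by simp

lemma b_diff_right: "x \<in> H \<Longrightarrow> y \<in> H \<Longrightarrow> y' \<in> H \<Longrightarrow> b x (y - y') = b x y - b x y'"
  using b_add_right[of x "y - y'" y'] by simp

section \<open>Invariant forms, Schur complements and the extreme feasible forms\<close>

definition inv_form :: "('h \<Rightarrow> real) \<Rightarrow> bool" where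
  "inv_form q \<longleftrightarrow> qform q \<and> (\<forall>x\<in>H. q (U x) = q x)"

lemma inv_form_imp_qform: "inv_form q \<Longrightarrow> qform q"
  by (simp add: inv_form_def)

lemma inv_form_U: "inv_form q \<Longrightarrow> x \<in> H \<Longrightarrow> q (U x) = q x"
  by (simp add: inv_form_def)

lemma inv_form_add: "inv_form p \<Longrightarrow> inv_form q \<Longrightarrow> inv_form (\<lambda>x. p x + q x)"
  by (simp add: inv_form_def qform_add)

lemma inv_form_diff: "inv_form p \<Longrightarrow> inv_form q \<Longrightarrow> inv_form (\<lambda>x. p x - q x)"
  by (simp add: inv_form_def qform_diff)

lemma inv_form_scale: "inv_form p \<Longrightarrow> inv_form (\<lambda>x. r * p x)"
  by (simp add: inv_form_def qform_scale)

lemma inv_form_cong: "inv_form p \<Longrightarrow> (\<And>x. x \<in> H \<Longrightarrow> q x = p x) \<Longrightarrow> inv_form q"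
  using qform_cong[of p q] by (simp add: inv_form_def)

lemma inv_form_chain_infimum:
  assumes ne: "I \<noteq> {}" and q: "\<And>i. i \<in> I \<Longrightarrow> inv_form (g i)"
    and nonneg: "\<And>i x. i \<in> I \<Longrightarrow> x \<in> H \<Longrightarrow> 0 \<le> g i x"
    and chain: "\<And>i j. i \<in> I \<Longrightarrow> j \<in> I \<Longrightarrow>
       (\<forall>x\<in>H. g i x \<le> g j x) \<or> (\<forall>x\<in>H. g j x \<le> g i x)"
    and f: "\<And>x. x \<in> H \<Longrightarrow> f x = (INF i\<in>I. g i x)"
  shows "inv_form f"
  unfolding inv_form_def
proof (intro conjI ballI)
  show "qform f"
    using q by (intro qform_chain_infimum[OF ne _ nonneg chain f]) (auto simp: inv_form_def)
  fix x assume "x \<in> H"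
  then show "f (U x) = f x" using q by (auto simp: f inv_form_def intro!: INF_cong)
qed

text \<open>Minimizing the block form over the second coordinate gives formally P - B* N^(-1) B, and
  makes sense even if N is not invertible.\<close>

definition schur :: "('h \<Rightarrow> real) \<Rightarrow> ('h \<Rightarrow> real) \<Rightarrow> 'h \<Rightarrow> real" where
  "schur p n x = (INF y\<in>H. p x + 2 * b x y + n y)"

text \<open>This is the positivity of the block operator, with operators replaced by their forms.
  Invariance of \<open>m\<close> is deliberately not demanded, since M ranges over all bounded
  operators.\<close>

definition feasible :: "('h \<Rightarrow> real) \<Rightarrow> ('h \<Rightarrow> real) \<Rightarrow> bool" where
  "feasible a m \<longleftrightarrow> qform m \<and> (\<forall>x\<in>H. \<forall>y\<in>H. 0 \<le> a x - m x + 2 * b x y + m y)"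

lemma feasibleD: "feasible a m \<Longrightarrow> x \<in> H \<Longrightarrow> y \<in> H \<Longrightarrow> 0 \<le> a x - m x + 2 * b x y + m y"
  by (simp add: feasible_def)

lemma feasible_le: "feasible a m \<Longrightarrow> x \<in> H \<Longrightarrow> m x \<le> a x"
  using feasibleD[of a m x 0] by (auto simp: feasible_def qform_zero b_zero_right)

lemma feasible_nonneg: "feasible a m \<Longrightarrow> qform a \<Longrightarrow> x \<in> H \<Longrightarrow> 0 \<le> m x"
  using feasibleD[of a m 0 x] b_real_left[of 0 x 0] by (auto simp: feasible_def qform_zero)

lemma feasible_mono:
  "feasible a m \<Longrightarrow> (\<And>x. x \<in> H \<Longrightarrow> a x \<le> a' x) \<Longrightarrow> feasible a' m"
  unfolding feasible_def by (meson add_right_mono diff_right_mono order_trans)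

text \<open>The block form is quadratic in the pair (x, y) jointly, so the second coordinates
  \<open>i + j\<close>, \<open>i - j\<close> and \<open>sc c i\<close> are the witnesses for an
  infimum over y. Invariance follows by reindexing y along \<open>U\<close>, which maps
  \<open>H\<close> onto \<open>H\<close>.\<close>

lemma inv_form_schur:
  assumes p: "inv_form p" and n: "inv_form n"
    and nonneg: "\<And>x y. x \<in> H \<Longrightarrow> y \<in> H \<Longrightarrow> 0 \<le> p x + 2 * b x y + n y"
  shows "inv_form (schur p n)"
  unfolding inv_form_def
proof (intro conjI ballI)
  note qp = inv_form_imp_qform[OF p] and qn = inv_form_imp_qform[OF n]
  show "qform (schur p n)"
  proof (rule qform_infimum[where I = H and g = "\<lambda>y x. p x + 2 * b x y + n y"])
    show "H \<noteq> {}" using zero_closed by blast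
    fix i j x y assume H: "i \<in> H" "j \<in> H" "x \<in> H" "y \<in> H"
    show "\<exists>k\<in>H. \<exists>l\<in>H. p (x + y) + 2 * b (x + y) k + n k + (p (x - y) + 2 * b (x - y) l + n l)
        \<le> 2 * (p x + 2 * b x i + n i) + 2 * (p y + 2 * b y j + n j)"
      using qform_parallelogram[OF qp, of x y] qform_parallelogram[OF qn, of i j] H
      by (intro bexI[of _ "i + j"] bexI[of _ "i - j"])
        (auto simp: b_add_left b_add_right b_diff_left b_diff_right)
  next
    fix i c x assume H: "i \<in> H" "x \<in> H"
    show "\<exists>k\<in>H. p (sc c x) + 2 * b (sc c x) k + n k \<le> (cmod c)\<^sup>2 * (p x + 2 * b x i + n i)"
      using H qp qn by (intro bexI[of _ "sc c i"]) (auto simp: qform_sc b_sc algebra_simps)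
  qed (auto simp: nonneg schur_def)
  fix x assume x: "x \<in> H"
  have "schur p n (U x) = (INF y\<in>U ` H. p (U x) + 2 * b (U x) y + n y)"
    by (simp add: schur_def U_image)
  also have "\<dots> = schur p n x"
    using p n x by (auto simp: image_image schur_def inv_form_U b_U intro!: INF_cong)
  finally show "schur p n (U x) = schur p n x" .
qed

lemma schur_le:
  assumes "\<And>x y. x \<in> H \<Longrightarrow> y \<in> H \<Longrightarrow> 0 \<le> p x + 2 * b x y + n y" "x \<in> H" "y \<in> H"
  shows "schur p n x \<le> p x + 2 * b x y + n y"
  unfolding schur_def using assms by (intro cINF_lower bdd_belowI2[where m=0]) auto

lemma schur_ge:
  "(\<And>y. y \<in> H \<Longrightarrow> t \<le> p x + 2 * b x y + n y) \<Longrightarrow> t \<le> schur p n x"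
  unfolding schur_def using zero_closed by (intro cINF_greatest) blast+

text \<open>The iterates \<open>a, a - B* a\<^sup>-\<^sup>1 B, \<dots>\<close> (in Schur complement form) decrease to the largest
  feasible form; being canonical, it is \<open>U\<close>-invariant.\<close>

lemma maximal_feasible:
  assumes a: "inv_form a" and m0: "feasible a m0"
  obtains n where "inv_form n" "feasible a n" "\<forall>m. feasible a m \<longrightarrow> (\<forall>x\<in>H. m x \<le> n x)"
proof -
  define N where "N k = (schur a ^^ k) a" for k :: nat
  have N_Suc: "N (Suc k) = schur a (N k)" for k by (simp add: N_def)
  have qa: "qform a" using a by (rule inv_form_imp_qform)
  \<comment> \<open>Feasibility of \<open>m\<close> amounts to \<open>m \<le> schur a m\<close>. As
    \<open>schur a\<close> is monotone, it sends an upper bound of all feasible forms to another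
    one.\<close>
  have lower: "m x \<le> a x + 2 * b x y + n y"
    if "feasible a m" "\<And>y. y \<in> H \<Longrightarrow> m y \<le> n y" "x \<in> H" "y \<in> H" for m n x y
    using feasibleD[OF that(1,3,4)] that(2)[OF that(4)] by linarith
  have N: "inv_form (N k) \<and> (\<forall>m x. feasible a m \<longrightarrow> x \<in> H \<longrightarrow> m x \<le> N k x)" for k
  proof (induction k)
    case 0
    then show ?case using a feasible_le by (simp add: N_def)
  next
    case (Suc k)
    have ge: "m x \<le> a x + 2 * b x y + N k y" if "feasible a m" "x \<in> H" "y \<in> H" for m x y
      using lower[OF that(1) _ that(2,3)] Suc that(1) by blast
    have pos: "0 \<le> a x + 2 * b x y + N k y" if "x \<in> H" "y \<in> H" for x y
      using ge[OF m0 that] feasible_nonneg[OF m0 qa that(1)] by linarith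
    show ?case unfolding N_Suc
      using inv_form_schur[OF a _ pos] Suc ge by (auto intro!: schur_ge)
  qed
  have N_ge: "m x \<le> N k x" if "feasible a m" "x \<in> H" for m k x using N that by blast
  \<comment> \<open>The given form \<open>m0\<close> lies between 0 and the block expression, which
    keeps every infimum bounded below.\<close>
  have pos: "0 \<le> a x + 2 * b x y + N k y" if x: "x \<in> H" and y: "y \<in> H" for x y k
  proof -
    have "m0 x \<le> a x + 2 * b x y + N k y" by (rule lower[OF m0 _ x y]) (rule N_ge[OF m0])
    then show ?thesis using feasible_nonneg[OF m0 qa x] by linarith
  qed
  have dec: "\<forall>x\<in>H. N (Suc k) x \<le> N k x" for k
  proof (induction k)
    case 0
    show ?case
    proof
      fix x assume x: "x \<in> H"
      have "N (Suc 0) x \<le> a x + 2 * b x 0 + N 0 0"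
        unfolding N_Suc using schur_le[OF pos x zero_closed] .
      then show "N (Suc 0) x \<le> N 0 x" using x qa by (simp add: N_def b_zero_right qform_zero)
    qed
  next
    case (Suc k)
    show ?case
    proof
      fix x assume x: "x \<in> H"
      show "N (Suc (Suc k)) x \<le> N (Suc k) x"
        unfolding N_Suc[of k]
      proof (rule schur_ge)
        fix y assume y: "y \<in> H"
        have "N (Suc (Suc k)) x \<le> a x + 2 * b x y + N (Suc k) y"
          unfolding N_Suc[of "Suc k"] by (rule schur_le[OF pos x y])
        then show "N (Suc (Suc k)) x \<le> a x + 2 * b x y + N k y" using Suc y by force
      qed
    qed
  qed
  have anti: "N l x \<le> N k x" if "k \<le> l" "x \<in> H" for k l x
    using lift_Suc_antimono_le[of "\<lambda>k. N k x" k l] dec that by blast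
  have N_nonneg: "0 \<le> N k x" if "x \<in> H" for k x
    using N_ge[OF m0 that] feasible_nonneg[OF m0 qa that] by (rule order_trans[rotated])
  define n where "n x = (INF k. N k x)" for x
  have n_le: "n x \<le> N k x" if "x \<in> H" for x k
    unfolding n_def using N_nonneg[OF that] by (intro cINF_lower bdd_belowI2[where m=0]) auto
  have inv: "inv_form n"
  proof (rule inv_form_chain_infimum[where I = UNIV and g = N])
    fix i j :: nat
    show "(\<forall>x\<in>H. N i x \<le> N j x) \<or> (\<forall>x\<in>H. N j x \<le> N i x)"
      using anti by (meson nat_le_linear)
  qed (use N N_nonneg in \<open>auto simp: n_def\<close>)
  have feas: "feasible a n"
    unfolding feasible_def
  proof (intro conjI ballI)
    \<comment> \<open>Feasibility passes to the limit with the indices offset by one: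
      \<open>n x\<close> lies below the iterate \<open>Suc k\<close>, which is the Schur complement
      of iterate \<open>k\<close>. The infimum over \<open>k\<close> is then taken in the second
      coordinate.\<close>
    fix x y assume x: "x \<in> H" and y: "y \<in> H"
    have "n x - a x - 2 * b x y \<le> N k y" for k
      using n_le[OF x, of "Suc k"] schur_le[where n = "N k", OF pos x y] by (simp add: N_Suc)
    then have "n x - a x - 2 * b x y \<le> n y"
      unfolding n_def[of y] by (intro cINF_greatest) auto
    then show "0 \<le> a x - n x + 2 * b x y + n y" by simp
  qed (rule inv_form_imp_qform[OF inv])
  have "\<forall>m. feasible a m \<longrightarrow> (\<forall>x\<in>H. m x \<le> n x)"
    unfolding n_def using N_ge by (auto intro!: cINF_greatest)
  with inv feas show ?thesis by (rule that)
qed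

text \<open>Interchanging the two coordinates exchanges the diagonal blocks \<open>a - m\<close> and
  \<open>m\<close> and transposes \<open>b\<close>.\<close>

lemma feasible_swapped:
  assumes "qform a" "feasible a m"
  shows "coupling.feasible H sc (\<lambda>x y. b y x) a (\<lambda>x. a x - m x)"
proof -
  interpret sw: coupling H sc U "\<lambda>x y. b y x" by (rule swapped)
  show ?thesis
    unfolding sw.feasible_def
  proof (intro conjI ballI)
    show "qform (\<lambda>x. a x - m x)" using assms by (auto simp: feasible_def qform_diff)
    fix x y assume "x \<in> H" "y \<in> H"
    then show "0 \<le> a x - (a x - m x) + 2 * b y x + (a y - m y)"
      using feasibleD[OF assms(2), of y x] by simp
  qed
qed

text \<open>The passage from \<open>m\<close> to \<open>a - m\<close> reverses the order, so this is
  the largest feasible form of the transposed problem, reflected back.\<close>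

lemma minimal_feasible:
  assumes a: "inv_form a" and m0: "feasible a m0"
  obtains n where "inv_form n" "feasible a n" "\<forall>m. feasible a m \<longrightarrow> (\<forall>x\<in>H. n x \<le> m x)"
proof -
  interpret sw: coupling H sc U "\<lambda>x y. b y x" by (rule swapped)
  have qa: "qform a" using a by (rule inv_form_imp_qform)
  obtain n where n: "inv_form n" "sw.feasible a n"
    and max: "\<forall>m. sw.feasible a m \<longrightarrow> (\<forall>x\<in>H. m x \<le> n x)"
    by (rule sw.maximal_feasible[OF a feasible_swapped[OF qa m0]])
  show ?thesis
  proof (rule that)
    show "inv_form (\<lambda>x. a x - n x)" using a n(1) by (rule inv_form_diff)
    show "feasible a (\<lambda>x. a x - n x)" using sw.feasible_swapped[OF qa n(2)] .
    show "\<forall>m. feasible a m \<longrightarrow> (\<forall>x\<in>H. a x - n x \<le> m x)"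
    proof (intro allI impI ballI)
      fix m x assume m: "feasible a m" and x: "x \<in> H"
      have "a x - m x \<le> n x" using max[rule_format, OF feasible_swapped[OF qa m] x] .
      then show "a x - n x \<le> m x" by simp
    qed
  qed
qed

text \<open>If \<open>(x, y)\<close> nearly annihilates the block form of the midpoint then, by Cauchy--Schwarz, both
  \<open>a x - m\<^sub>i x + b x y\<close> are small.\<close>

lemma feasible_eq_of_schur_midpoint_zero:
  assumes a: "qform a" and m1: "feasible a m1" and m2: "feasible a m2" and x: "x \<in> H"
    and zero: "schur (\<lambda>x. a x - (m1 x + m2 x) / 2) (\<lambda>x. (m1 x + m2 x) / 2) x = 0"
  shows "m1 x = m2 x"
proof -
  have bound: "(a x - m x + b x y)\<^sup>2 \<le> (a x - m x + 2 * b x y + m y) * (a x - m x)"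
    if m: "feasible a m" and y: "y \<in> H" for m y
  proof (rule quadratic_nonneg_discrim)
    \<comment> \<open>The block form is evaluated at (x, y) + t (x, 0), so the discriminant gives
      Cauchy--Schwarz for the pairs (x, y) and (x, 0).\<close>
    fix t :: real
    have "0 \<le> a (sc (complex_of_real (1 + t)) x) - m (sc (complex_of_real (1 + t)) x)
        + 2 * b (sc (complex_of_real (1 + t)) x) y + m y"
      using x y by (intro feasibleD[OF m]) auto
    also have "\<dots> = (1 + t)\<^sup>2 * a x - (1 + t)\<^sup>2 * m x + 2 * ((1 + t) * b x y) + m y"
      using m a x y unfolding feasible_def by (simp only: qform_sc b_real_left norm_of_real power2_abs)
    finally show "0 \<le> a x - m x + 2 * b x y + m y + 2 * t * (a x - m x + b x y) + t\<^sup>2 * (a x - m x)"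
      by (simp add: power2_eq_square algebra_simps)
  qed
  define P where "P = (a x - m1 x) + (a x - m2 x)"
  have P: "0 \<le> P" "a x - m1 x \<le> P" "a x - m2 x \<le> P" "0 \<le> a x - m1 x" "0 \<le> a x - m2 x"
    using feasible_le[OF m1 x] feasible_le[OF m2 x] by (auto simp: P_def)
  have "(m2 x - m1 x)\<^sup>2 \<le> 0 + e" if e: "0 < e" for e
  proof -
    \<comment> \<open>Chosen so that \<open>2 * d * (P + 1) = e / 4\<close>, which bounds each of
      the two squares below; \<open>P + 1\<close> in place of \<open>P\<close> avoids a zero
      denominator.\<close>
    define d where "d = e / (8 * (P + 1))"
    have d: "0 < d" using e P by (simp add: d_def)
    have dP: "(2 * d) * (P + 1) = e / 4"
    proof -
      have "P + 1 \<noteq> 0" using P by linarith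
      then show ?thesis unfolding d_def by (simp add: divide_simps del: distrib_left_numeral)
    qed
    have "\<exists>y\<in>H. a x - (m1 x + m2 x) / 2 + 2 * b x y + (m1 y + m2 y) / 2 < d"
    proof (rule ccontr)
      assume "\<not> ?thesis"
      then have "d \<le> schur (\<lambda>x. a x - (m1 x + m2 x) / 2) (\<lambda>x. (m1 x + m2 x) / 2) x"
        by (intro schur_ge) (auto simp: not_less)
      then show False using zero d by simp
    qed
    then obtain y where y: "y \<in> H"
      and lt: "a x - (m1 x + m2 x) / 2 + 2 * b x y + (m1 y + m2 y) / 2 < d" by blast
    define q1 where "q1 = a x - m1 x + 2 * b x y + m1 y"
    \<comment> \<open>\<open>q1\<close> and \<open>q2\<close> are the block forms of the two
      extremes at (x, y). Their sum is twice that of the midpoint, and both are nonnegative, so each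
      is at most \<open>2 * d\<close>.\<close>
    define q2 where "q2 = a x - m2 x + 2 * b x y + m2 y"
    have q: "0 \<le> q1" "0 \<le> q2" "q1 + q2 \<le> 2 * d"
      using feasibleD[OF m1 x y] feasibleD[OF m2 x y] lt by (auto simp: q1_def q2_def field_simps)
    have "(a x - m1 x + b x y)\<^sup>2 \<le> q1 * (a x - m1 x)"
      using bound[OF m1 y] by (simp add: q1_def)
    also have "\<dots> \<le> (2 * d) * (P + 1)" using q P by (intro mult_mono) auto
    finally have 1: "(a x - m1 x + b x y)\<^sup>2 \<le> e / 4" using dP by simp
    have "(a x - m2 x + b x y)\<^sup>2 \<le> q2 * (a x - m2 x)"
      using bound[OF m2 y] by (simp add: q2_def)
    also have "\<dots> \<le> (2 * d) * (P + 1)" using q P by (intro mult_mono) auto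
    finally have 2: "(a x - m2 x + b x y)\<^sup>2 \<le> e / 4" using dP by simp
    \<comment> \<open>In the difference of the two small quantities \<open>a x\<close> and
      \<open>b x y\<close> cancel, leaving \<open>m2 x - m1 x\<close>; its square is at most 2 (e/4
      + e/4) = e.\<close>
    have "(u - v)\<^sup>2 \<le> 2 * u\<^sup>2 + 2 * v\<^sup>2" for u v :: real
      using zero_le_power2[of "u + v"] by (simp add: power2_eq_square algebra_simps)
    from this[of "a x - m1 x + b x y" "a x - m2 x + b x y"] 1 2 show ?thesis by simp
  qed
  then have "(m2 x - m1 x)\<^sup>2 \<le> 0" by (rule field_le_epsilon)
  then show ?thesis by simp
qed

section \<open>A minimal invariant form and the uniqueness of its feasible form\<close>

lemma exists_minimal_form:
  assumes a: "inv_form a" and m0: "feasible a m0"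
  obtains \<alpha> m where "inv_form \<alpha>" "feasible \<alpha> m" "\<forall>x\<in>H. \<alpha> x \<le> a x"
    "\<forall>\<beta> m. inv_form \<beta> \<longrightarrow> feasible \<beta> m \<longrightarrow> (\<forall>x\<in>H. \<beta> x \<le> \<alpha> x) \<longrightarrow> (\<forall>x\<in>H. \<beta> x = \<alpha> x)"
proof -
  \<comment> \<open>The members vanish outside \<open>H\<close>, so that the order of functions on
    the whole type is the order on \<open>H\<close> and is antisymmetric there.\<close>
  define AA where "AA = {\<alpha>. inv_form \<alpha> \<and> (\<exists>m. feasible \<alpha> m) \<and> (\<forall>x\<in>H. \<alpha> x \<le> a x)
    \<and> (\<forall>x. x \<notin> H \<longrightarrow> \<alpha> x = 0)}"
  define cut where "cut f x = (if x \<in> H then f x else 0)" for f :: "'h \<Rightarrow> real" and x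
  have cut_in: "cut \<alpha> \<in> AA" if "inv_form \<alpha>" "feasible \<alpha> m" "\<forall>x\<in>H. \<alpha> x \<le> a x" for \<alpha> m
    using that inv_form_cong[of \<alpha> "cut \<alpha>"] feasible_mono[of \<alpha> m "cut \<alpha>"]
    by (auto simp: AA_def cut_def)
  have "\<exists>m\<in>AA. \<forall>\<beta>\<in>AA. m \<ge> \<beta> \<longrightarrow> \<beta> = m"
  proof (rule predicate_Zorn)
    show "partial_order_on AA (relation_of (\<ge>) AA)"
      by (rule partial_order_on_relation_ofI) auto
    fix C assume C: "C \<in> Chains (relation_of (\<ge>) AA)"
    have sub: "\<beta> \<in> AA" if "\<beta> \<in> C" for \<beta>
      using Chains_relation_of[OF C] that by blast
    have tot: "\<beta> \<le> \<gamma> \<or> \<gamma> \<le> \<beta>" if "\<beta> \<in> C" "\<gamma> \<in> C" for \<beta> \<gamma>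
      using C that unfolding Chains_def relation_of_def by blast
    show "\<exists>u\<in>AA. \<forall>\<beta>\<in>C. \<beta> \<ge> u"
    proof (cases "C = {}")
      case True
      then show ?thesis using cut_in[OF a m0] by auto
    next
      case ne: False
      have inv: "inv_form \<beta>" if "\<beta> \<in> C" for \<beta> using sub[OF that] by (auto simp: AA_def)
      have "\<forall>\<beta>\<in>C. \<exists>n. inv_form n \<and> feasible \<beta> n \<and> (\<forall>m. feasible \<beta> m \<longrightarrow> (\<forall>x\<in>H. m x \<le> n x))"
      proof
        fix \<beta> assume "\<beta> \<in> C"
        then have "inv_form \<beta>" "\<exists>m. feasible \<beta> m" using sub by (auto simp: AA_def)
        then show "\<exists>n. inv_form n \<and> feasible \<beta> n \<and> (\<forall>m. feasible \<beta> m \<longrightarrow> (\<forall>x\<in>H. m x \<le> n x))"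
          using maximal_feasible by metis
      qed
      then obtain N where N: "\<And>\<beta>. \<beta> \<in> C \<Longrightarrow> inv_form (N \<beta>)" "\<And>\<beta>. \<beta> \<in> C \<Longrightarrow> feasible \<beta> (N \<beta>)"
        and Nmax': "\<forall>\<beta>\<in>C. \<forall>m. feasible \<beta> m \<longrightarrow> (\<forall>x\<in>H. m x \<le> N \<beta> x)"
        by metis
      have Nmax: "m x \<le> N \<beta> x" if "\<beta> \<in> C" "feasible \<beta> m" "x \<in> H" for \<beta> m x
        using Nmax' that by blast
      have N_nonneg: "0 \<le> N \<beta> x" if "\<beta> \<in> C" "x \<in> H" for \<beta> x
        using feasible_nonneg[OF N(2)] inv that by (auto simp: inv_form_def)
      have C_nonneg: "0 \<le> \<beta> x" if "\<beta> \<in> C" "x \<in> H" for \<beta> x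
        using N_nonneg[OF that] feasible_le[OF N(2)] that by force
      \<comment> \<open>What is feasible for the smaller form is feasible for the larger one, hence
        below its largest feasible form.\<close>
      have N_mono: "N \<beta> x \<le> N \<gamma> x" if "\<beta> \<in> C" "\<gamma> \<in> C" "\<beta> \<le> \<gamma>" "x \<in> H" for \<beta> \<gamma> x
        using Nmax[OF that(2) feasible_mono[OF N(2)[OF that(1)]] that(4)] that(3)
        by (auto simp: le_fun_def)
      define \<alpha> where "\<alpha> x = (INF \<beta>\<in>C. \<beta> x)" for x
      define n where "n x = (INF \<beta>\<in>C. N \<beta> x)" for x
      have \<alpha>_inv: "inv_form \<alpha>"
      proof (rule inv_form_chain_infimum[OF ne, where g = "\<lambda>\<beta>. \<beta>"])
        fix i j assume "i \<in> C" "j \<in> C"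
        then show "(\<forall>x\<in>H. i x \<le> j x) \<or> (\<forall>x\<in>H. j x \<le> i x)" using tot[of i j] by (auto simp: le_fun_def)
      qed (use inv C_nonneg \<alpha>_def in auto)
      have n_inv: "inv_form n"
      proof (rule inv_form_chain_infimum[OF ne, where g = N])
        fix i j assume "i \<in> C" "j \<in> C"
        then show "(\<forall>x\<in>H. N i x \<le> N j x) \<or> (\<forall>x\<in>H. N j x \<le> N i x)"
          using tot[of i j] N_mono[of i j] N_mono[of j i] by blast
      qed (use N N_nonneg n_def in auto)
      have n_le: "n x \<le> N \<beta> x" if "\<beta> \<in> C" "x \<in> H" for \<beta> x
        unfolding n_def using N_nonneg that by (intro cINF_lower bdd_belowI2[where m=0]) auto
      have \<alpha>_le: "\<alpha> x \<le> \<beta> x" if "\<beta> \<in> C" "x \<in> H" for \<beta> x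
        unfolding \<alpha>_def using C_nonneg that by (intro cINF_lower bdd_belowI2[where m=0]) auto
      \<comment> \<open>Two independent indices are used so that the infima defining
        \<open>\<alpha> x\<close> and \<open>n y\<close> can be taken separately. Feasibility is
        applied at the smaller of the two forms.\<close>
      have key: "0 \<le> \<beta> x - n x + 2 * b x y + N \<gamma> y"
        if H: "\<beta> \<in> C" "\<gamma> \<in> C" "x \<in> H" "y \<in> H" for \<beta> \<gamma> x y
      proof (cases "\<beta> \<le> \<gamma>")
        case True
        then show ?thesis
          using feasibleD[OF N(2)[OF H(1)] H(3,4)] n_le[OF H(1,3)] N_mono[OF H(1,2) True H(4)] by linarith
      next
        case False
        then have "\<gamma> \<le> \<beta>" using tot[OF H(1,2)] by blast
        then have "\<gamma> x \<le> \<beta> x" by (simp add: le_fun_def)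
        then show ?thesis
          using feasibleD[OF N(2)[OF H(2)] H(3,4)] n_le[OF H(2,3)] by linarith
      qed
      have feas: "feasible \<alpha> n"
        unfolding feasible_def
      proof (intro conjI ballI)
        fix x y assume x: "x \<in> H" and y: "y \<in> H"
        have 1: "n x - 2 * b x y - N \<gamma> y \<le> \<alpha> x" if "\<gamma> \<in> C" for \<gamma>
          unfolding \<alpha>_def using key[OF _ that x y] ne by (intro cINF_greatest) (auto simp: algebra_simps)
        have "n x - 2 * b x y - \<alpha> x \<le> n y"
          unfolding n_def[of y] using 1 ne by (intro cINF_greatest) (auto simp: algebra_simps)
        then show "0 \<le> \<alpha> x - n x + 2 * b x y + n y" by simp
      qed (rule inv_form_imp_qform[OF n_inv])
      obtain \<beta>0 where \<beta>0: "\<beta>0 \<in> C" using ne by blast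
      have "\<forall>x\<in>H. \<alpha> x \<le> a x"
        using \<alpha>_le[OF \<beta>0] sub[OF \<beta>0] unfolding AA_def by force
      then have "cut \<alpha> \<in> AA" by (rule cut_in[OF \<alpha>_inv feas])
      moreover have "cut \<alpha> \<le> \<beta>" if "\<beta> \<in> C" for \<beta>
        using \<alpha>_le[OF that] sub[OF that] by (auto simp: le_fun_def cut_def AA_def)
      ultimately show ?thesis by blast
    qed
  qed
  then obtain \<alpha> where \<alpha>: "\<alpha> \<in> AA" and min: "\<And>\<beta>. \<beta> \<in> AA \<Longrightarrow> \<beta> \<le> \<alpha> \<Longrightarrow> \<beta> = \<alpha>" by blast
  then obtain m where m: "feasible \<alpha> m" by (auto simp: AA_def)
  show ?thesis
  proof (rule that[of \<alpha> m])
    show "\<forall>\<beta> m. inv_form \<beta> \<longrightarrow> feasible \<beta> m \<longrightarrow> (\<forall>x\<in>H. \<beta> x \<le> \<alpha> x) \<longrightarrow> (\<forall>x\<in>H. \<beta> x = \<alpha> x)"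
    proof (intro allI impI ballI)
      fix \<beta> m' x
      assume \<beta>: "inv_form \<beta>" "feasible \<beta> m'" and le: "\<forall>x\<in>H. \<beta> x \<le> \<alpha> x" and x: "x \<in> H"
      have "\<forall>x\<in>H. \<beta> x \<le> a x" using le \<alpha> unfolding AA_def by force
      then have "cut \<beta> \<in> AA" by (rule cut_in[OF \<beta>])
      moreover have "cut \<beta> \<le> \<alpha>" using le \<alpha> by (auto simp: le_fun_def cut_def AA_def)
      ultimately have "cut \<beta> = \<alpha>" by (rule min)
      then have "cut \<beta> x = \<alpha> x" by simp
      then show "\<beta> x = \<alpha> x" using x by (simp add: cut_def)
    qed
  next
    show "inv_form \<alpha>" "feasible \<alpha> m" using \<alpha> m by (auto simp: AA_def)
    show "\<forall>x\<in>H. \<alpha> x \<le> a x" using \<alpha> unfolding AA_def by blast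
  qed
qed

lemma exists_form_with_unique_feasible:
  assumes a: "inv_form a" and m0: "feasible a m0"
  obtains \<alpha> m where "inv_form \<alpha>" "\<forall>x\<in>H. \<alpha> x \<le> a x" "inv_form m" "feasible \<alpha> m"
    "\<forall>m'. feasible \<alpha> m' \<longrightarrow> (\<forall>x\<in>H. m' x = m x)"
proof -
  obtain \<alpha> m1 where \<alpha>: "inv_form \<alpha>" and m1: "feasible \<alpha> m1"
    and le: "\<forall>x\<in>H. \<alpha> x \<le> a x"
    and min: "\<forall>\<beta> m. inv_form \<beta> \<longrightarrow> feasible \<beta> m \<longrightarrow> (\<forall>x\<in>H. \<beta> x \<le> \<alpha> x) \<longrightarrow> (\<forall>x\<in>H. \<beta> x = \<alpha> x)"
    by (rule exists_minimal_form[OF a m0])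
  obtain u where u: "inv_form u" "feasible \<alpha> u" and umax: "\<forall>m. feasible \<alpha> m \<longrightarrow> (\<forall>x\<in>H. m x \<le> u x)"
    by (rule maximal_feasible[OF \<alpha> m1])
  obtain l where l: "inv_form l" "feasible \<alpha> l" and lmin: "\<forall>m. feasible \<alpha> m \<longrightarrow> (\<forall>x\<in>H. l x \<le> m x)"
    by (rule minimal_feasible[OF \<alpha> m1])
  define h where "h x = (u x + l x) / 2" for x
  define p where "p x = \<alpha> x - h x" for x
  have h: "inv_form h"
    using inv_form_scale[OF inv_form_add[OF u(1) l(1)], of "1/2"] by (simp add: h_def[abs_def])
  have p: "inv_form p" unfolding p_def[abs_def] by (rule inv_form_diff[OF \<alpha> h])
  have pos: "0 \<le> p x + 2 * b x y + h y" if "x \<in> H" "y \<in> H" for x y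
    using feasibleD[OF u(2) that] feasibleD[OF l(2) that] by (simp add: p_def h_def field_simps)
  define D where "D = schur p h"
  have D: "inv_form D" unfolding D_def by (rule inv_form_schur[OF p h pos])
  have D_nonneg: "0 \<le> D x" if "x \<in> H" for x unfolding D_def using pos that by (intro schur_ge) auto
  \<comment> \<open>\<open>D\<close> depends on x alone and lies below the block form of
    \<open>h\<close>, so after taking it off \<open>\<alpha>\<close> the same \<open>h\<close>
    remains feasible.\<close>
  have "feasible (\<lambda>x. \<alpha> x - D x) h"
    unfolding feasible_def
  proof (intro conjI ballI)
    fix x y assume "x \<in> H" "y \<in> H"
    then have "D x \<le> p x + 2 * b x y + h y" unfolding D_def by (intro schur_le pos)
    then show "0 \<le> \<alpha> x - D x - h x + 2 * b x y + h y" by (simp add: p_def)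
  qed (rule inv_form_imp_qform[OF h])
  moreover have "\<forall>x\<in>H. \<alpha> x - D x \<le> \<alpha> x" using D_nonneg by simp
  ultimately have "\<forall>x\<in>H. \<alpha> x - D x = \<alpha> x"
    using min[rule_format, OF inv_form_diff[OF \<alpha> D]] by blast
  then have "D x = 0" if "x \<in> H" for x using that by force
  then have "schur (\<lambda>x. \<alpha> x - (u x + l x) / 2) (\<lambda>x. (u x + l x) / 2) x = 0" if "x \<in> H" for x
    using that by (simp add: D_def p_def[abs_def] h_def[abs_def])
  then have eq: "u x = l x" if "x \<in> H" for x
    using feasible_eq_of_schur_midpoint_zero[OF inv_form_imp_qform[OF \<alpha>] u(2) l(2) that] that by blast
  show ?thesis
  proof (rule that[OF \<alpha> le u])
    show "\<forall>m'. feasible \<alpha> m' \<longrightarrow> (\<forall>x\<in>H. m' x = u x)"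
    proof (intro allI impI ballI)
      fix m' x assume m': "feasible \<alpha> m'" and x: "x \<in> H"
      have "m' x \<le> u x" "l x \<le> m' x" using umax lmin m' x by blast+
      then show "m' x = u x" using eq[OF x] by simp
    qed
  qed
qed

end

section \<open>Hilbert space\<close>

text \<open>Boundedness on the unit interval replaces continuity. With r the fractional part of n t,
  additivity gives n (f t - t f 1) = f r - r f 1, which is bounded independently of n.\<close>

lemma additive_bounded_imp_linear:
  fixes f :: "real \<Rightarrow> real"
  assumes add: "\<And>s t. f (s + t) = f s + f t" and bnd: "\<And>t. 0 \<le> t \<Longrightarrow> t \<le> 1 \<Longrightarrow> \<bar>f t\<bar> \<le> K"
  shows "f t = t * f 1"
proof -
  interpret additive f by unfold_locales (rule add)
  have nat: "f (real n * s) = real n * f s" for n s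
    by (induction n) (simp_all add: zero add algebra_simps)
  have int: "f (of_int k) = of_int k * f 1" for k
    using nat[of "nat k" 1] nat[of "nat (- k)" 1] minus[of "of_int k"]
    by (cases "0 \<le> k") simp_all
  have "real n * \<bar>f t - t * f 1\<bar> \<le> K + \<bar>f 1\<bar>" for n
  proof -
    define r where "r = frac (real n * t)"
    have r: "0 \<le> r" "r \<le> 1" by (simp_all add: r_def less_imp_le[OF frac_lt_1])
    have nt: "real n * t = of_int \<lfloor>real n * t\<rfloor> + r" by (simp add: r_def frac_def)
    have "real n * f t = of_int \<lfloor>real n * t\<rfloor> * f 1 + f r"
      using nat[of n t] add[of "of_int \<lfloor>real n * t\<rfloor>" r] nt int by simp
    moreover have "real n * t * f 1 = of_int \<lfloor>real n * t\<rfloor> * f 1 + r * f 1"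
      by (subst nt) (simp add: algebra_simps)
    ultimately have "real n * (f t - t * f 1) = f r - r * f 1" by (simp add: algebra_simps)
    then have "real n * \<bar>f t - t * f 1\<bar> = \<bar>f r - r * f 1\<bar>"
      by (metis abs_mult abs_of_nat)
    also have "\<dots> \<le> \<bar>f r\<bar> + \<bar>r * f 1\<bar>" by (rule abs_triangle_ineq4)
    also have "\<dots> \<le> K + 1 * \<bar>f 1\<bar>"
      using bnd[OF r] r by (intro add_mono) (auto simp: abs_mult intro!: mult_left_le_one_le)
    finally show ?thesis by simp
  qed
  then have "\<bar>f t - t * f 1\<bar> \<le> 0"
    by (metis ex_less_of_nat_mult not_le)
  then show ?thesis by simp
qed

text \<open>The laws of \<open>ip\<close> are restricted to \<open>H\<close> because the infinite
  sum defining the inner product of sequences behaves well only for square-summable ones.\<close>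

locale cinner = csubspace H sc for H :: "'h::ab_group_add set" and sc +
  fixes ip :: "'h \<Rightarrow> 'h \<Rightarrow> complex"
  assumes ip_add_left: "x \<in> H \<Longrightarrow> y \<in> H \<Longrightarrow> z \<in> H \<Longrightarrow> ip (x + y) z = ip x z + ip y z"
    and ip_sc_left: "x \<in> H \<Longrightarrow> y \<in> H \<Longrightarrow> ip (sc c x) y = c * ip x y"
    and ip_cnj: "x \<in> H \<Longrightarrow> y \<in> H \<Longrightarrow> ip y x = cnj (ip x y)"
    and ip_nonneg: "x \<in> H \<Longrightarrow> 0 \<le> Re (ip x x)"
    and ip_definite: "x \<in> H \<Longrightarrow> ip x x = 0 \<Longrightarrow> x = 0"
begin

text \<open>The real part determines the whole inner product, as \<open>Im_ip\<close> shows; it is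
  the bilinear form that polarization of a real quadratic form produces.\<close>

definition rip :: "'h \<Rightarrow> 'h \<Rightarrow> real" where "rip x y = Re (ip x y)"

lemma ip_add_right: "x \<in> H \<Longrightarrow> y \<in> H \<Longrightarrow> z \<in> H \<Longrightarrow> ip z (x + y) = ip z x + ip z y"
  using ip_cnj[of "x + y" z] ip_cnj[of x z] ip_cnj[of y z] by (simp add: ip_add_left)

lemma ip_sc_right: "x \<in> H \<Longrightarrow> y \<in> H \<Longrightarrow> ip y (sc c x) = cnj c * ip y x"
  using ip_cnj[of "sc c x" y] ip_cnj[of x y] by (simp add: ip_sc_left)

lemma rip_commute: "x \<in> H \<Longrightarrow> y \<in> H \<Longrightarrow> rip x y = rip y x"
  using ip_cnj[of x y] by (simp add: rip_def)

lemma rip_add_left: "x \<in> H \<Longrightarrow> y \<in> H \<Longrightarrow> z \<in> H \<Longrightarrow> rip (x + y) z = rip x z + rip y z"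
  by (simp add: rip_def ip_add_left)

lemma rip_add_right: "x \<in> H \<Longrightarrow> y \<in> H \<Longrightarrow> z \<in> H \<Longrightarrow> rip z (x + y) = rip z x + rip z y"
  by (simp add: rip_def ip_add_right)

lemma rip_diff_left: "x \<in> H \<Longrightarrow> y \<in> H \<Longrightarrow> z \<in> H \<Longrightarrow> rip (x - y) z = rip x z - rip y z"
  using rip_add_left[of "x - y" y z] by simp

lemma rip_diff_right: "x \<in> H \<Longrightarrow> y \<in> H \<Longrightarrow> z \<in> H \<Longrightarrow> rip z (x - y) = rip z x - rip z y"
  using rip_add_right[of "x - y" y z] by simp

lemma rip_real_left: "x \<in> H \<Longrightarrow> y \<in> H \<Longrightarrow> rip (sc (complex_of_real r) x) y = r * rip x y"
  by (simp add: rip_def ip_sc_left)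

lemma rip_real_right: "x \<in> H \<Longrightarrow> y \<in> H \<Longrightarrow> rip x (sc (complex_of_real r) y) = r * rip x y"
  by (simp add: rip_def ip_sc_right)

lemma rip_sc_sc: "x \<in> H \<Longrightarrow> y \<in> H \<Longrightarrow> rip (sc c x) (sc c y) = (cmod c)\<^sup>2 * rip x y"
proof -
  assume "x \<in> H" "y \<in> H"
  then have "ip (sc c x) (sc c y) = (c * cnj c) * ip x y"
    by (simp add: ip_sc_left ip_sc_right mult.assoc)
  then show ?thesis
    unfolding rip_def by (simp flip: complex_norm_square of_real_power)
qed

lemma Im_ip: "x \<in> H \<Longrightarrow> y \<in> H \<Longrightarrow> Im (ip x y) = rip x (sc \<i> y)"
  by (simp add: rip_def ip_sc_right)

lemma ip_eqI:
  assumes "x \<in> H" "y \<in> H" "x' \<in> H" "y' \<in> H"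
    and "rip x y = rip x' y'" "rip x (sc \<i> y) = rip x' (sc \<i> y')"
  shows "ip x y = ip x' y'"
  using assms by (simp add: complex_eq_iff Im_ip) (simp add: rip_def)

lemma hnorm_nonneg: "x \<in> H \<Longrightarrow> 0 \<le> hnorm ip x"
  using ip_nonneg by (simp add: hnorm_def)

lemma hnorm_power2: "x \<in> H \<Longrightarrow> (hnorm ip x)\<^sup>2 = rip x x"
  using ip_nonneg by (simp add: hnorm_def rip_def)

lemma hnorm_sc: "x \<in> H \<Longrightarrow> hnorm ip (sc c x) = cmod c * hnorm ip x"
  using rip_sc_sc[of x x c] unfolding hnorm_def rip_def by (simp add: real_sqrt_mult)

lemma hnorm_zero [simp]: "hnorm ip 0 = 0"
  using hnorm_sc[of 0 0] by simp

lemma hnorm_eq_zero: "x \<in> H \<Longrightarrow> hnorm ip x = 0 \<Longrightarrow> x = 0"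
proof -
  assume x: "x \<in> H" "hnorm ip x = 0"
  then have "Re (ip x x) = 0" using hnorm_power2[of x] by (simp add: rip_def)
  moreover have "Im (ip x x) = 0" using ip_cnj[of x x] x by (simp add: complex_eq_iff)
  ultimately show ?thesis using x ip_definite[of x] by (simp add: complex_eq_iff)
qed

lemma rip_Cauchy_Schwarz:
  assumes x: "x \<in> H" and y: "y \<in> H"
  shows "\<bar>rip x y\<bar> \<le> hnorm ip x * hnorm ip y"
proof -
  have "(rip x y)\<^sup>2 \<le> rip x x * rip y y"
  proof (rule quadratic_nonneg_discrim)
    fix t :: real
    let ?y = "sc (complex_of_real t) y"
    have "0 \<le> rip (x + ?y) (x + ?y)" using x y ip_nonneg by (simp add: rip_def)
    also have "\<dots> = rip x x + 2 * t * rip x y + t\<^sup>2 * rip y y"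
      using x y by (simp add: rip_add_left rip_add_right rip_real_left rip_real_right
          rip_commute[of y x] power2_eq_square algebra_simps)
    finally show "0 \<le> rip x x + 2 * t * rip x y + t\<^sup>2 * rip y y" .
  qed
  also have "\<dots> = (hnorm ip x * hnorm ip y)\<^sup>2" using x y by (simp add: hnorm_power2 power_mult_distrib)
  finally show ?thesis
    using hnorm_nonneg x y by (metis abs_le_square_iff abs_of_nonneg mult_nonneg_nonneg)
qed

text \<open>A crude estimate, in the shape needed to dominate the series of inner products by the
  two summable series of squared norms.\<close>

lemma ip_bound:
  assumes x: "x \<in> H" and y: "y \<in> H"
  shows "cmod (ip x y) \<le> (hnorm ip x)\<^sup>2 + (hnorm ip y)\<^sup>2"
proof -
  have "cmod (ip x y) \<le> \<bar>Re (ip x y)\<bar> + \<bar>Im (ip x y)\<bar>" by (rule cmod_le)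
  also have "\<dots> \<le> 2 * hnorm ip x * hnorm ip y"
    using rip_Cauchy_Schwarz[OF x y] rip_Cauchy_Schwarz[OF x sc_closed[OF y], of \<i>] x y
    by (simp add: Im_ip hnorm_sc) (simp add: rip_def)
  also have "\<dots> \<le> (hnorm ip x)\<^sup>2 + (hnorm ip y)\<^sup>2"
    using sum_squares_bound[of "hnorm ip x" "hnorm ip y"] by simp
  finally show ?thesis .
qed

lemma qform_hnorm: "qform (\<lambda>x. (hnorm ip x)\<^sup>2)"
  unfolding qform_def
  by (auto simp: hnorm_power2 rip_add_left rip_add_right rip_diff_left rip_diff_right rip_sc_sc)

lemma hnorm_triangle:
  assumes x: "x \<in> H" and y: "y \<in> H"
  shows "hnorm ip (x + y) \<le> hnorm ip x + hnorm ip y"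
proof (rule power2_le_imp_le)
  have "(hnorm ip (x + y))\<^sup>2 = rip x x + 2 * rip x y + rip y y"
    using x y by (simp add: hnorm_power2 rip_add_left rip_add_right rip_commute[of y x])
  also have "\<dots> \<le> (hnorm ip x + hnorm ip y)\<^sup>2"
    using rip_Cauchy_Schwarz[OF x y] x y by (simp add: power2_sum hnorm_power2)
  finally show "(hnorm ip (x + y))\<^sup>2 \<le> (hnorm ip x + hnorm ip y)\<^sup>2" .
  show "0 \<le> hnorm ip x + hnorm ip y" using hnorm_nonneg x y by simp
qed

lemma eq_if_rip_eq:
  assumes "x \<in> H" "x' \<in> H" "\<And>y. y \<in> H \<Longrightarrow> rip x y = rip x' y"
  shows "x = x'"
proof -
  have "(hnorm ip (x - x'))\<^sup>2 = 0"
    using assms by (simp add: hnorm_power2 rip_diff_left)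
  then show ?thesis using hnorm_eq_zero[of "x - x'"] assms by simp
qed

section \<open>Polarization of quadratic forms\<close>

definition polar :: "('h \<Rightarrow> real) \<Rightarrow> 'h \<Rightarrow> 'h \<Rightarrow> real" where
  "polar q x y = (q (x + y) - q (x - y)) / 4"

context
  fixes q assumes q: "qform q"
begin

lemma polar_commute: "x \<in> H \<Longrightarrow> y \<in> H \<Longrightarrow> polar q x y = polar q y x"
  using qform_uminus[OF q, of "x - y"] by (simp add: polar_def add.commute)

lemma polar_self: "x \<in> H \<Longrightarrow> polar q x x = q x"
  using qform_sc[OF q, of x 2] qform_zero[OF q] by (simp add: polar_def sc_two)

lemma polar_sc_sc: "x \<in> H \<Longrightarrow> y \<in> H \<Longrightarrow> polar q (sc c x) (sc c y) = (cmod c)\<^sup>2 * polar q x y"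
  using qform_sc[OF q, of "x + y" c] qform_sc[OF q, of "x - y" c]
  by (simp add: polar_def sc_add_right sc_diff_right algebra_simps)

text \<open>Since 1 + i and 1 - i have the same modulus, both terms agree. For the operator T
  represented by \<open>q\<close> this says that the inner product of T x with x is real.\<close>

lemma polar_i: "x \<in> H \<Longrightarrow> polar q x (sc \<i> x) = 0"
proof -
  assume x: "x \<in> H"
  have "x + sc \<i> x = sc (1 + \<i>) x" "x - sc \<i> x = sc (1 - \<i>) x"
    using sc_add_left[of 1 "\<i>" x] sc_add_left[of 1 "- \<i>" x] by (simp_all add: sc_uminus_left)
  then show ?thesis using x by (simp add: polar_def qform_sc[OF q] cmod_def)
qed

text \<open>The argument of Jordan and von Neumann: subtracting the parallelogram laws for (u + y, v
  + y) and (u - y, v - y) cancels \<open>q (u - v)\<close> and leaves \<open>half\<close>. Its case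
  v = 0 then removes the factor 2.\<close>

lemma polar_add_left:
  assumes x: "x \<in> H" and x': "x' \<in> H" and y: "y \<in> H"
  shows "polar q (x + x') y = polar q x y + polar q x' y"
proof -
  have half: "polar q u y + polar q v y = polar q (u + v) (sc 2 y) / 2" if u: "u \<in> H" and v: "v \<in> H" for u v
  proof -
    have 1: "q (u + v + sc 2 y) + q (u - v) = 2 * q (u + y) + 2 * q (v + y)"
      using qform_parallelogram[OF q, of "u + y" "v + y"] u v y by (simp add: sc_two algebra_simps)
    have 2: "q (u + v - sc 2 y) + q (u - v) = 2 * q (u - y) + 2 * q (v - y)"
      using qform_parallelogram[OF q, of "u - y" "v - y"] u v y by (simp add: sc_two algebra_simps)
    show ?thesis using 1 2 by (simp add: polar_def field_simps)
  qed
  have zero: "polar q 0 y = 0" using qform_uminus[OF q y] by (simp add: polar_def)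
  show ?thesis using half[OF x x'] half[of "x + x'" 0] x x' zero by simp
qed

lemma polar_add_right:
  "x \<in> H \<Longrightarrow> y \<in> H \<Longrightarrow> y' \<in> H \<Longrightarrow> polar q x (y + y') = polar q x y + polar q x y'"
  using polar_add_left polar_commute by simp

text \<open>Nonnegativity of \<open>q\<close> and the parallelogram law bound the additive function
  of the scalar on the unit interval, which forces it to be linear.\<close>

lemma polar_real_left:
  assumes q_nonneg: "\<forall>x\<in>H. 0 \<le> q x" and x: "x \<in> H" and y: "y \<in> H"
  shows "polar q (sc (complex_of_real r) x) y = r * polar q x y"
proof -
  have "polar q (sc (complex_of_real r) x) y = r * polar q (sc (complex_of_real 1) x) y"
  proof (rule additive_bounded_imp_linear[where K = "q x + q y"])
    fix s t
    show "polar q (sc (complex_of_real (s + t)) x) y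
        = polar q (sc (complex_of_real s) x) y + polar q (sc (complex_of_real t) x) y"
      using x y by (simp add: sc_add_left polar_add_left)
  next
    fix t :: real assume t: "0 \<le> t" "t \<le> 1"
    let ?x = "sc (complex_of_real t) x"
    have "\<bar>polar q ?x y\<bar> \<le> (q (?x + y) + q (?x - y)) / 4"
      using q_nonneg[THEN bspec, of "?x + y"] q_nonneg[THEN bspec, of "?x - y"] x y by (auto simp: polar_def)
    also have "\<dots> = (t\<^sup>2 * q x + q y) / 2"
      using x y qform_parallelogram[OF q, of ?x y] qform_sc[OF q x, of t] by (simp add: field_simps)
    also have "\<dots> \<le> q x + q y"
      using t q_nonneg[THEN bspec, OF x] q_nonneg[THEN bspec, OF y] mult_right_mono[of "t\<^sup>2" 1 "q x"] power_le_one[of t 2] by simp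
    finally show "\<bar>polar q ?x y\<bar> \<le> q x + q y" .
  qed
  then show ?thesis by simp
qed

lemma polar_real_right:
  "\<forall>x\<in>H. 0 \<le> q x \<Longrightarrow> x \<in> H \<Longrightarrow> y \<in> H \<Longrightarrow> polar q x (sc (complex_of_real r) y) = r * polar q x y"
  using polar_real_left polar_commute by simp

lemma polar_bound:
  assumes q_nonneg: "\<forall>x\<in>H. 0 \<le> q x"
    and q_bound: "\<forall>x\<in>H. q x \<le> C * (hnorm ip x)\<^sup>2" and C: "0 \<le> C" and x: "x \<in> H" and y: "y \<in> H"
  shows "\<bar>polar q x y\<bar> \<le> C * hnorm ip x * hnorm ip y"
proof -
  have "(polar q x y)\<^sup>2 \<le> q x * q y"
  proof (rule quadratic_nonneg_discrim)
    fix t :: real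
    let ?y = "sc (complex_of_real t) y"
    have "0 \<le> polar q (x + ?y) (x + ?y)" using x y q_nonneg by (simp add: polar_self)
    also have "\<dots> = polar q x x + 2 * t * polar q x y + t\<^sup>2 * polar q y y"
      using x y by (simp add: polar_add_left polar_add_right polar_real_left[OF q_nonneg]
          polar_real_right[OF q_nonneg] polar_commute[of y x] power2_eq_square algebra_simps)
    finally show "0 \<le> q x + 2 * t * polar q x y + t\<^sup>2 * q y" using x y by (simp add: polar_self)
  qed
  also have "\<dots> \<le> (C * (hnorm ip x)\<^sup>2) * (C * (hnorm ip y)\<^sup>2)"
    using q_bound q_nonneg x y C by (intro mult_mono) auto
  also have "\<dots> = (C * hnorm ip x * hnorm ip y)\<^sup>2" by (simp add: power2_eq_square algebra_simps)
  finally show ?thesis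
    using hnorm_nonneg x y C by (metis abs_le_square_iff abs_of_nonneg mult_nonneg_nonneg)
qed

end

end

section \<open>Riesz representation\<close>

locale chilbert = cinner +
  assumes complete: "\<And>X. range X \<subseteq> H \<Longrightarrow>
      (\<forall>e>0. \<exists>N. \<forall>m\<ge>N. \<forall>n\<ge>N. hnorm ip (X m - X n) < e) \<Longrightarrow>
      \<exists>l\<in>H. (\<lambda>n. hnorm ip (X n - l)) \<longlonglongrightarrow> 0"
begin

text \<open>The representing vector is the minimizer of the strictly convex functional
  \<open>J\<close>: minimizing sequences are Cauchy by the parallelogram law, and the first
  variation at the limit vanishes.\<close>

lemma Riesz_representation:
  fixes \<psi> :: "'a \<Rightarrow> real"
  assumes add: "\<And>x y. x \<in> H \<Longrightarrow> y \<in> H \<Longrightarrow> \<psi> (x + y) = \<psi> x + \<psi> y"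
    and real: "\<And>r x. x \<in> H \<Longrightarrow> \<psi> (sc (complex_of_real r) x) = r * \<psi> x"
    and bound: "\<And>x. x \<in> H \<Longrightarrow> \<bar>\<psi> x\<bar> \<le> C * hnorm ip x"
  shows "\<exists>z\<in>H. \<forall>y\<in>H. rip z y = \<psi> y"
proof -
  define J where "J y = (hnorm ip y)\<^sup>2 - 2 * \<psi> y" for y
  define m where "m = (INF y\<in>H. J y)"
  have "- C\<^sup>2 \<le> J y" if y: "y \<in> H" for y
  proof -
    have "\<psi> y \<le> C * hnorm ip y" using bound[OF y] by simp
    moreover have "0 \<le> (hnorm ip y - C)\<^sup>2" by simp
    ultimately show ?thesis unfolding J_def power2_diff by (simp add: algebra_simps)
  qed
  then have m_le: "m \<le> J y" if "y \<in> H" for y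
    unfolding m_def using that by (intro cINF_lower bdd_belowI2) auto
  have "\<exists>y\<in>H. J y < m + 1 / real (Suc n)" for n
  proof (rule ccontr)
    assume "\<not> ?thesis"
    then have "m + 1 / real (Suc n) \<le> J y" if "y \<in> H" for y using that by (simp add: not_less)
    moreover have "H \<noteq> {}" using zero_closed by blast
    ultimately have "m + 1 / real (Suc n) \<le> m"
      unfolding m_def by (intro cINF_greatest)
    then show False by simp
  qed
  then obtain Y where Y: "\<And>n. Y n \<in> H" and YJ: "\<And>n. J (Y n) < m + 1 / real (Suc n)" by metis
  have dist: "(hnorm ip (Y i - Y j))\<^sup>2 \<le> 2 / real (Suc i) + 2 / real (Suc j)" for i j
  proof -
    \<comment> \<open>At the midpoint \<open>J\<close> is still at least \<open>m\<close>, so two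
      near-minimizers must be close to each other.\<close>
    define w where "w = sc (complex_of_real (1/2)) (Y i + Y j)"
    have w: "w \<in> H" using Y by (simp add: w_def)
    have "(hnorm ip w)\<^sup>2 = (1/4) * (hnorm ip (Y i + Y j))\<^sup>2"
      using Y unfolding w_def by (subst hnorm_sc) (auto simp: power_mult_distrib power2_eq_square)
    moreover have "\<psi> w = (1/2) * (\<psi> (Y i) + \<psi> (Y j))"
      using Y unfolding w_def by (subst real) (auto simp: add)
    moreover have "(hnorm ip (Y i + Y j))\<^sup>2 + (hnorm ip (Y i - Y j))\<^sup>2
        = 2 * (hnorm ip (Y i))\<^sup>2 + 2 * (hnorm ip (Y j))\<^sup>2"
      using qform_parallelogram[OF qform_hnorm Y Y] .
    ultimately have "(hnorm ip (Y i - Y j))\<^sup>2 = 2 * J (Y i) + 2 * J (Y j) - 4 * J w"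
      unfolding J_def by (simp add: algebra_simps)
    then show ?thesis using YJ[of i] YJ[of j] m_le[OF w] by simp
  qed
  have "\<forall>e>0. \<exists>N. \<forall>i\<ge>N. \<forall>j\<ge>N. hnorm ip (Y i - Y j) < e"
  proof (intro allI impI)
    fix e :: real assume e: "0 < e"
    obtain N where N: "4 / e\<^sup>2 < real N" using reals_Archimedean2 by blast
    have "hnorm ip (Y i - Y j) < e" if ij: "N \<le> i" "N \<le> j" for i j
    proof (rule power2_less_imp_less)
      have bd: "2 / real (Suc k) < e\<^sup>2 / 2" if "N \<le> k" for k
      proof -
        have "4 / e\<^sup>2 < real (Suc k)" using N that by linarith
        then show ?thesis using e by (simp add: divide_simps mult.commute)
      qed
      show "(hnorm ip (Y i - Y j))\<^sup>2 < e\<^sup>2" using dist[of i j] bd[OF ij(1)] bd[OF ij(2)] by linarith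
    qed (use e in simp)
    then show "\<exists>N. \<forall>i\<ge>N. \<forall>j\<ge>N. hnorm ip (Y i - Y j) < e" by blast
  qed
  then obtain l where l: "l \<in> H" and lim: "(\<lambda>n. hnorm ip (Y n - l)) \<longlonglongrightarrow> 0"
    using complete[of Y] Y by blast
  have "rip l v = \<psi> v" if v: "v \<in> H" for v
  proof -
    \<comment> \<open>Perturbing \<open>Y n\<close> along v cannot bring \<open>J\<close> below
      \<open>m\<close>; the discriminant therefore bounds the first variation already at the
      approximate minimizers, before the limit is taken.\<close>
    have sq: "(rip (Y n) v - \<psi> v)\<^sup>2 \<le> (J (Y n) - m) * rip v v" for n
    proof (rule quadratic_nonneg_discrim)
      fix t :: real
      let ?v = "sc (complex_of_real t) v"
      have "m \<le> J (Y n + ?v)" using Y v by (intro m_le) auto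
      also have "\<dots> = J (Y n) + 2 * t * (rip (Y n) v - \<psi> v) + t\<^sup>2 * rip v v"
        using Y[of n] v by (simp add: J_def hnorm_power2 rip_add_left rip_add_right rip_real_left
            rip_real_right rip_commute[of v "Y n"] add real algebra_simps) (simp add: power2_eq_square)
      finally show "0 \<le> J (Y n) - m + 2 * t * (rip (Y n) v - \<psi> v) + t\<^sup>2 * rip v v" by simp
    qed
    have "(\<lambda>n. (rip (Y n) v - \<psi> v)\<^sup>2) \<longlonglongrightarrow> 0"
    proof (rule tendsto_sandwich[OF _ _ tendsto_const])
      have "(rip (Y n) v - \<psi> v)\<^sup>2 \<le> (1 / real (Suc n)) * rip v v" for n
        using ip_nonneg[OF v] YJ[of n]
        by (intro order_trans[OF sq] mult_right_mono) (auto simp: rip_def)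
      then show "\<forall>\<^sub>F n in sequentially. (rip (Y n) v - \<psi> v)\<^sup>2 \<le> (1 / real (Suc n)) * rip v v" by simp
      show "(\<lambda>n. (1 / real (Suc n)) * rip v v) \<longlonglongrightarrow> 0"
        using tendsto_mult_left_zero[OF LIMSEQ_Suc[OF lim_1_over_n]] by simp
    qed simp
    then have "(\<lambda>n. rip (Y n) v - \<psi> v) \<longlonglongrightarrow> 0" by simp
    moreover have "(\<lambda>n. rip (Y n) v - rip l v) \<longlonglongrightarrow> 0"
    proof (rule Lim_null_comparison)
      show "\<forall>\<^sub>F n in sequentially. norm (rip (Y n) v - rip l v) \<le> hnorm ip (Y n - l) * hnorm ip v"
        using rip_Cauchy_Schwarz[of "Y _ - l" v] Y l v by (simp add: rip_diff_left)
      show "(\<lambda>n. hnorm ip (Y n - l) * hnorm ip v) \<longlonglongrightarrow> 0" using tendsto_mult_left_zero[OF lim] .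
    qed
    ultimately have "(\<lambda>n. (rip (Y n) v - \<psi> v) - (rip (Y n) v - rip l v)) \<longlonglongrightarrow> 0 - 0" by (rule tendsto_diff)
    then have "(\<lambda>n::nat. rip l v - \<psi> v) \<longlonglongrightarrow> 0" by simp
    then show ?thesis using LIMSEQ_const_iff[of "rip l v - \<psi> v" 0] by simp
  qed
  then show ?thesis using l by blast
qed

end

section \<open>Square-summable sequences and Toeplitz operators\<close>

definition seq_scale :: "(complex \<Rightarrow> 'k \<Rightarrow> 'k) \<Rightarrow> complex \<Rightarrow> (int \<Rightarrow> 'k) \<Rightarrow> int \<Rightarrow> 'k" where
  "seq_scale sc c f = (\<lambda>n. sc c (f n))"

definition trunc :: "int set \<Rightarrow> (int \<Rightarrow> 'k::zero) \<Rightarrow> int \<Rightarrow> 'k" where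
  "trunc F f = (\<lambda>n. if n \<in> F then f n else 0)"

definition shift :: "(int \<Rightarrow> 'k) \<Rightarrow> int \<Rightarrow> 'k" where
  "shift f = (\<lambda>n. f (n - 1))"

lemma shift_delta: "shift (delta k x) = delta (k + 1) x"
  by (auto simp: shift_def delta_def fun_eq_iff)

lemma shift_add: "shift (f + g) = shift f + shift g"
  by (simp add: shift_def fun_eq_iff)

lemma trunc_empty: "trunc {} f = 0"
  by (simp add: trunc_def fun_eq_iff)

lemma trunc_insert: "k \<notin> F \<Longrightarrow> trunc (insert k F) f = delta k (f k) + trunc F f" for f :: "int \<Rightarrow> 'k::ab_group_add"
  by (auto simp: trunc_def delta_def fun_eq_iff)

lemma delta_add: "delta k (x + y) = delta k x + delta k y" for x :: "'k::ab_group_add"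
  by (auto simp: delta_def fun_eq_iff)

lemma bij_pred_int: "bij (\<lambda>n::int. n - 1)"
  by (rule bij_diff_right)

locale hilbert_sequences = K: chilbert "UNIV :: 'k::ab_group_add set" sc ip for sc ip
begin

lemma K_hnorm_add_power2: "(hnorm ip (x + y))\<^sup>2 \<le> 2 * (hnorm ip x)\<^sup>2 + 2 * (hnorm ip y)\<^sup>2"
  using K.qform_parallelogram[OF K.qform_hnorm, of x y, simplified] zero_le_power2[of "hnorm ip (x - y)"]
  by linarith

lemma L2_summable: "f \<in> L2 ip \<Longrightarrow> (\<lambda>n. (hnorm ip (f n))\<^sup>2) summable_on UNIV"
  by (simp add: L2_def)

lemma ip_summable:
  assumes "f \<in> L2 ip" "g \<in> L2 ip"
  shows "(\<lambda>n. ip (f n) (g n)) summable_on UNIV"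
proof (rule Infinite_Sum.abs_summable_summable, rule Infinite_Sum.abs_summable_on_comparison_test')
  show "(\<lambda>n. (hnorm ip (f n))\<^sup>2 + (hnorm ip (g n))\<^sup>2) summable_on UNIV"
    using assms by (intro summable_on_add L2_summable)
qed (rule K.ip_bound, simp_all)

sublocale L: cinner "L2 ip" "seq_scale sc" "l2ip ip"
proof
  show "0 \<in> L2 ip" by (simp add: L2_def)
  show add: "f + g \<in> L2 ip" if "f \<in> L2 ip" "g \<in> L2 ip" for f g
    unfolding L2_def
  proof (simp, rule summable_on_comparison_test)
    show "(\<lambda>n. 2 * (hnorm ip (f n))\<^sup>2 + 2 * (hnorm ip (g n))\<^sup>2) summable_on UNIV"
      using that by (intro summable_on_add summable_on_cmult_right L2_summable)
  qed (simp_all add: K_hnorm_add_power2)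
  show "seq_scale sc c f \<in> L2 ip" if "f \<in> L2 ip" for c f
    using summable_on_cmult_right[OF L2_summable[OF that], of "(cmod c)\<^sup>2"]
    by (simp add: L2_def seq_scale_def K.hnorm_sc power_mult_distrib)
  show "seq_scale sc 1 f = f" for f by (simp add: seq_scale_def)
  show "seq_scale sc c (seq_scale sc d f) = seq_scale sc (c * d) f" for c d f
    by (simp add: seq_scale_def)
  show "seq_scale sc (c + d) f = seq_scale sc c f + seq_scale sc d f" for c d f
    by (simp add: seq_scale_def K.sc_add_left fun_eq_iff)
  show "seq_scale sc c (f + g) = seq_scale sc c f + seq_scale sc c g" for c f g
    by (simp add: seq_scale_def K.sc_add_right fun_eq_iff)
  show "l2ip ip (f + g) h = l2ip ip f h + l2ip ip g h"
    if "f \<in> L2 ip" "g \<in> L2 ip" "h \<in> L2 ip" for f g h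
    using that by (simp add: l2ip_def K.ip_add_left ip_summable infsum_add)
  show "l2ip ip (seq_scale sc c f) g = c * l2ip ip f g" if "f \<in> L2 ip" "g \<in> L2 ip" for c f g
    using that by (simp add: l2ip_def seq_scale_def K.ip_sc_left ip_summable infsum_cmult_right)
  show "l2ip ip g f = cnj (l2ip ip f g)" if "f \<in> L2 ip" "g \<in> L2 ip" for f g
    unfolding l2ip_def infsum_cnj[symmetric] by (intro infsum_cong K.ip_cnj) simp_all
  have Re: "Re (l2ip ip f f) = (\<Sum>\<^sub>\<infinity>n. (hnorm ip (f n))\<^sup>2)" if "f \<in> L2 ip" for f
    using infsum_Re[OF ip_summable[OF that that]] by (simp add: l2ip_def K.hnorm_power2 K.rip_def)
  show "0 \<le> Re (l2ip ip f f)" if "f \<in> L2 ip" for f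
    unfolding Re[OF that] by (intro infsum_nonneg) simp
  show "f = 0" if f: "f \<in> L2 ip" and z: "l2ip ip f f = 0" for f
  proof
    fix n
    have "(hnorm ip (f n))\<^sup>2 = 0"
      using Re[OF f] z L2_summable[OF f] by (intro nonneg_infsum_le_0D[where A = UNIV]) auto
    then show "f n = 0 n" using K.hnorm_eq_zero[of "f n"] by simp
  qed
qed

lemma rip_has_sum:
  assumes "f \<in> L2 ip" "g \<in> L2 ip"
  shows "((\<lambda>n. K.rip (f n) (g n)) has_sum L.rip f g) UNIV"
  using has_sum_Re[OF has_sum_infsum[OF ip_summable[OF assms]]]
  by (simp add: K.rip_def L.rip_def l2ip_def)

lemma l2norm_power2_has_sum:
  "f \<in> L2 ip \<Longrightarrow> ((\<lambda>n. (hnorm ip (f n))\<^sup>2) has_sum (hnorm (l2ip ip) f)\<^sup>2) UNIV"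
  using rip_has_sum[of f f] by (simp add: K.hnorm_power2 L.hnorm_power2)

lemma l2norm_eq: "f \<in> L2 ip \<Longrightarrow> l2norm ip f = hnorm (l2ip ip) f"
  using infsumI[OF l2norm_power2_has_sum] L.hnorm_nonneg[of f] by (simp add: l2norm_def)

lemma trunc_L2_power2:
  assumes "finite F"
  shows "trunc F f \<in> L2 ip" "(hnorm (l2ip ip) (trunc F f))\<^sup>2 = (\<Sum>n\<in>F. (hnorm ip (f n))\<^sup>2)"
proof -
  have s: "((\<lambda>n. (hnorm ip (trunc F f n))\<^sup>2) has_sum (\<Sum>n\<in>F. (hnorm ip (f n))\<^sup>2)) UNIV"
    using assms by (intro has_sum_finite_neutralI[of F]) (auto simp: trunc_def)
  then show m: "trunc F f \<in> L2 ip" by (simp add: L2_def has_sum_imp_summable)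
  show "(hnorm (l2ip ip) (trunc F f))\<^sup>2 = (\<Sum>n\<in>F. (hnorm ip (f n))\<^sup>2)"
    using has_sum_unique[OF l2norm_power2_has_sum[OF m] s] .
qed

lemma delta_L2: "delta k x \<in> L2 ip"
  and hnorm_delta: "hnorm (l2ip ip) (delta k x) = hnorm ip x"
proof -
  have d: "delta k x = trunc {k} (\<lambda>_. x)" by (auto simp: delta_def trunc_def)
  show m: "delta k x \<in> L2 ip" unfolding d by (rule trunc_L2_power2) simp
  have "(hnorm (l2ip ip) (delta k x))\<^sup>2 = (hnorm ip x)\<^sup>2"
    unfolding d by (subst trunc_L2_power2) simp_all
  then show "hnorm (l2ip ip) (delta k x) = hnorm ip x"
    using L.hnorm_nonneg[OF m] K.hnorm_nonneg[of x] by simp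
qed

text \<open>By Pythagoras the squared norm of the tail is the squared norm of f minus a partial sum
  of its series.\<close>

lemma trunc_tendsto:
  assumes f: "f \<in> L2 ip"
  shows "((\<lambda>F. hnorm (l2ip ip) (f - trunc F f)) \<longlongrightarrow> 0) (finite_subsets_at_top UNIV)"
proof -
  have eq: "(hnorm (l2ip ip) (f - trunc F f))\<^sup>2 = (hnorm (l2ip ip) f)\<^sup>2 - (\<Sum>n\<in>F. (hnorm ip (f n))\<^sup>2)"
    if F: "finite F" for F
  proof -
    have m: "f - trunc F f \<in> L2 ip" using f trunc_L2_power2[OF F] by simp
    have "((\<lambda>n. (hnorm ip (f n))\<^sup>2 + - (hnorm ip (trunc F f n))\<^sup>2) has_sum
        (hnorm (l2ip ip) f)\<^sup>2 + - (\<Sum>n\<in>F. (hnorm ip (f n))\<^sup>2)) UNIV"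
      using l2norm_power2_has_sum[OF f] l2norm_power2_has_sum[OF trunc_L2_power2(1)[OF F], of f]
      unfolding trunc_L2_power2(2)[OF F] by (intro has_sum_add) (auto simp: has_sum_uminus)
    moreover have "(\<lambda>n. (hnorm ip (f n))\<^sup>2 + - (hnorm ip (trunc F f n))\<^sup>2)
        = (\<lambda>n. (hnorm ip ((f - trunc F f) n))\<^sup>2)"
      by (auto simp: trunc_def fun_eq_iff)
    ultimately show ?thesis using has_sum_unique[OF l2norm_power2_has_sum[OF m]] by simp
  qed
  have "((\<lambda>F. (hnorm (l2ip ip) f)\<^sup>2 - (\<Sum>n\<in>F. (hnorm ip (f n))\<^sup>2)) \<longlongrightarrow>
      (hnorm (l2ip ip) f)\<^sup>2 - (hnorm (l2ip ip) f)\<^sup>2) (finite_subsets_at_top UNIV)"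
    using l2norm_power2_has_sum[OF f] unfolding has_sum_def by (intro tendsto_diff tendsto_const)
  then have "((\<lambda>F. (hnorm (l2ip ip) (f - trunc F f))\<^sup>2) \<longlongrightarrow>
      (hnorm (l2ip ip) f)\<^sup>2 - (hnorm (l2ip ip) f)\<^sup>2) (finite_subsets_at_top UNIV)"
    by (rule Lim_transform_eventually) (auto simp: eq intro!: eventually_finite_subsets_at_top_weakI)
  then show ?thesis by simp
qed

section \<open>Bounded operators and their representation by bounded forms\<close>

lemma bounded_op_closed: "bounded_op sc ip T \<Longrightarrow> f \<in> L2 ip \<Longrightarrow> T f \<in> L2 ip"
  by (simp add: bounded_op_def)

lemma bounded_op_add:
  "bounded_op sc ip T \<Longrightarrow> f \<in> L2 ip \<Longrightarrow> g \<in> L2 ip \<Longrightarrow> T (f + g) = T f + T g"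
  by (simp add: bounded_op_def plus_fun_def)

lemma bounded_op_scale:
  "bounded_op sc ip T \<Longrightarrow> f \<in> L2 ip \<Longrightarrow> T (seq_scale sc c f) = seq_scale sc c (T f)"
  by (simp add: bounded_op_def seq_scale_def)

lemma bounded_op_diff:
  "bounded_op sc ip T \<Longrightarrow> f \<in> L2 ip \<Longrightarrow> g \<in> L2 ip \<Longrightarrow> T (f - g) = T f - T g"
  using bounded_op_add[of T "f - g" g] by (simp add: eq_diff_eq)

lemma bounded_op_zero: "bounded_op sc ip T \<Longrightarrow> T 0 = 0"
  using bounded_op_diff[of T 0 0] by simp

lemma bounded_op_bound:
  assumes "bounded_op sc ip T"
  obtains C where "0 \<le> C" "\<forall>f\<in>L2 ip. hnorm (l2ip ip) (T f) \<le> C * hnorm (l2ip ip) f"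
proof -
  obtain C where C: "\<forall>f\<in>L2 ip. l2norm ip (T f) \<le> C * l2norm ip f"
    using assms by (auto simp: bounded_op_def)
  have "hnorm (l2ip ip) (T f) \<le> max C 0 * hnorm (l2ip ip) f" if f: "f \<in> L2 ip" for f
  proof -
    have "hnorm (l2ip ip) (T f) \<le> C * hnorm (l2ip ip) f"
      using bspec[OF C f] f bounded_op_closed[OF assms f] by (simp add: l2norm_eq)
    also have "\<dots> \<le> max C 0 * hnorm (l2ip ip) f"
      using L.hnorm_nonneg[OF f] by (intro mult_right_mono) auto
    finally show ?thesis .
  qed
  then show ?thesis by (intro that[of "max C 0"]) auto
qed

lemma bounded_opI:
  assumes "\<And>f. f \<in> L2 ip \<Longrightarrow> T f \<in> L2 ip"
    and "\<And>f g. f \<in> L2 ip \<Longrightarrow> g \<in> L2 ip \<Longrightarrow> T (f + g) = T f + T g"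
    and "\<And>c f. f \<in> L2 ip \<Longrightarrow> T (seq_scale sc c f) = seq_scale sc c (T f)"
    and "\<And>f. f \<in> L2 ip \<Longrightarrow> hnorm (l2ip ip) (T f) \<le> C * hnorm (l2ip ip) f"
  shows "bounded_op sc ip T"
  using assms unfolding bounded_op_def by (fastforce simp: l2norm_eq plus_fun_def seq_scale_def)

text \<open>Riesz representation is applied in the coefficient space, one coordinate
  \<open>j\<close> at a time, to the functional k -> \<open>s x (delta j k)\<close>; the
  representing vectors are the entries of T x. Although \<open>s\<close> is real valued,
  \<open>sc_sc\<close> makes T complex linear.\<close>

lemma bounded_form_representation:
  fixes s :: "(int \<Rightarrow> 'k) \<Rightarrow> (int \<Rightarrow> 'k) \<Rightarrow> real"
  assumes add_left: "\<And>x x' y. x \<in> L2 ip \<Longrightarrow> x' \<in> L2 ip \<Longrightarrow> y \<in> L2 ip \<Longrightarrow> s (x + x') y = s x y + s x' y"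
    and add_right: "\<And>x y y'. x \<in> L2 ip \<Longrightarrow> y \<in> L2 ip \<Longrightarrow> y' \<in> L2 ip \<Longrightarrow> s x (y + y') = s x y + s x y'"
    and real_right: "\<And>r x y. x \<in> L2 ip \<Longrightarrow> y \<in> L2 ip \<Longrightarrow> s x (seq_scale sc (complex_of_real r) y) = r * s x y"
    and sc_sc: "\<And>c x y. x \<in> L2 ip \<Longrightarrow> y \<in> L2 ip \<Longrightarrow>
        s (seq_scale sc c x) (seq_scale sc c y) = (cmod c)\<^sup>2 * s x y"
    and bound: "\<And>x y. x \<in> L2 ip \<Longrightarrow> y \<in> L2 ip \<Longrightarrow> \<bar>s x y\<bar> \<le> C * hnorm (l2ip ip) x * hnorm (l2ip ip) y"
  shows "\<exists>T. bounded_op sc ip T \<and> (\<forall>x\<in>L2 ip. \<forall>y\<in>L2 ip. L.rip (T x) y = s x y)"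
proof -
  have "\<exists>z. \<forall>k. K.rip z k = s x (delta j k)" if x: "x \<in> L2 ip" for x j
  proof -
    have "delta j (sc c k) = seq_scale sc c (delta j k)" for c k
      by (auto simp: delta_def seq_scale_def fun_eq_iff)
    then have "\<exists>z\<in>UNIV. \<forall>k\<in>UNIV. K.rip z k = s x (delta j k)"
      using bound[OF x delta_L2, of j]
      by (intro K.Riesz_representation[where C = "C * hnorm (l2ip ip) x"])
        (simp_all add: delta_add add_right real_right x delta_L2 hnorm_delta)
    then show ?thesis by blast
  qed
  then obtain T where T: "\<And>x j k. x \<in> L2 ip \<Longrightarrow> K.rip (T x j) k = s x (delta j k)" by metis
  have s_zero: "s x 0 = 0" if "x \<in> L2 ip" for x using real_right[OF that that, of 0] by simp
  have s_trunc: "s x (trunc F y) = (\<Sum>j\<in>F. K.rip (T x j) (y j))" if x: "x \<in> L2 ip" and "finite F" for x y F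
    using that(2)
  proof (induction F)
    case empty
    show ?case by (simp only: trunc_empty s_zero[OF x] sum.empty)
  next
    case (insert k F)
    then show ?case by (simp add: trunc_insert add_right x delta_L2 trunc_L2_power2 T del: plus_fun_apply)
  qed
  have T_L2: "T x \<in> L2 ip" if x: "x \<in> L2 ip" for x
    unfolding L2_def
  proof (safe, rule nonneg_bdd_above_summable_on)
    have "(\<Sum>j\<in>F. (hnorm ip (T x j))\<^sup>2) \<le> (C * hnorm (l2ip ip) x)\<^sup>2" if F: "finite F" for F
    proof -
      \<comment> \<open>Testing \<open>s x\<close> on the truncation of T x itself gives
        \<open>w\<^sup>2 \<le> C * hnorm (l2ip ip) x * w\<close>, a bound on the partial sums that
        does not depend on \<open>F\<close>.\<close>
      define w where "w = hnorm (l2ip ip) (trunc F (T x))"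
      have w2: "w\<^sup>2 = (\<Sum>j\<in>F. (hnorm ip (T x j))\<^sup>2)" unfolding w_def by (rule trunc_L2_power2[OF F])
      have w0: "0 \<le> w" unfolding w_def by (intro L.hnorm_nonneg trunc_L2_power2 F)
      have "w\<^sup>2 = s x (trunc F (T x))" unfolding w2 s_trunc[OF x F] by (simp add: K.hnorm_power2)
      also have "\<dots> \<le> C * hnorm (l2ip ip) x * w"
        using bound[OF x trunc_L2_power2(1)[OF F], of "T x"] by (simp add: w_def)
      finally have "w * w \<le> C * hnorm (l2ip ip) x * w" by (simp add: power2_eq_square)
      then have "w \<le> \<bar>C * hnorm (l2ip ip) x\<bar>"
        using w0 by (cases "w = 0") (auto simp: mult_le_cancel_right)
      then show ?thesis using w0 w2 by (metis power2_abs power_mono)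
    qed
    then show "bdd_above (sum (\<lambda>n. (hnorm ip (T x n))\<^sup>2) ` {F. F \<subseteq> UNIV \<and> finite F})"
      by (intro bdd_aboveI2) auto
  qed simp
  have rep: "L.rip (T x) y = s x y" if x: "x \<in> L2 ip" and y: "y \<in> L2 ip" for x y
  proof -
    have "((\<lambda>F. s x (trunc F y)) \<longlongrightarrow> L.rip (T x) y) (finite_subsets_at_top UNIV)"
      using rip_has_sum[OF T_L2[OF x] y] unfolding has_sum_def
      by (rule Lim_transform_eventually)
        (auto simp: s_trunc[OF x] intro!: eventually_finite_subsets_at_top_weakI)
    moreover have "((\<lambda>F. s x (trunc F y)) \<longlongrightarrow> s x y) (finite_subsets_at_top UNIV)"
    proof (rule Lim_transform[OF tendsto_const], rule Lim_null_comparison)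
      show "((\<lambda>F. C * hnorm (l2ip ip) x * hnorm (l2ip ip) (y - trunc F y)) \<longlongrightarrow> 0) (finite_subsets_at_top UNIV)"
        using tendsto_mult_left[OF trunc_tendsto[OF y], of "C * hnorm (l2ip ip) x"] by simp
      have "norm (s x (trunc F y) - s x y) \<le> C * hnorm (l2ip ip) x * hnorm (l2ip ip) (y - trunc F y)"
        if F: "finite F" for F
      proof -
        have "s x y = s x (y - trunc F y) + s x (trunc F y)"
          using add_right[of x "y - trunc F y" "trunc F y"] x y trunc_L2_power2[OF F] by simp
        then show ?thesis using bound[of x "y - trunc F y"] x y trunc_L2_power2(1)[OF F] by simp
      qed
      then show "\<forall>\<^sub>F F in finite_subsets_at_top UNIV. norm (s x (trunc F y) - s x y)
          \<le> C * hnorm (l2ip ip) x * hnorm (l2ip ip) (y - trunc F y)"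
        by (auto intro!: eventually_finite_subsets_at_top_weakI)
    qed
    ultimately show ?thesis by (intro tendsto_unique[OF finite_subsets_at_top_neq_bot])
  qed
  have "bounded_op sc ip T"
  proof (rule bounded_opI[OF T_L2])
    fix f g assume "f \<in> L2 ip" "g \<in> L2 ip"
    then show "T (f + g) = T f + T g"
      by (intro L.eq_if_rip_eq) (simp_all add: T_L2 rep add_left L.rip_add_left)
  next
    fix c f assume f: "f \<in> L2 ip"
    show "T (seq_scale sc c f) = seq_scale sc c (T f)"
    proof (cases "c = 0")
      case True
      have "s 0 y = 0" if "y \<in> L2 ip" for y using add_left[of 0 0 y] that by simp
      then have "T 0 = 0"
        by (intro L.eq_if_rip_eq) (simp_all add: T_L2 rep L.rip_diff_left[of 0 0, simplified])
      then show ?thesis using True f by (simp add: T_L2)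
    next
      case False
      have "L.rip (T (seq_scale sc c f)) y = L.rip (seq_scale sc c (T f)) y" if y: "y \<in> L2 ip" for y
      proof -
        \<comment> \<open>Every test vector is a multiple by c, so \<open>sc_sc\<close> applies to
          both arguments and the factor can be moved outside T.\<close>
        define z where "z = seq_scale sc (inverse c) y"
        have z: "z \<in> L2 ip" "y = seq_scale sc c z" using y False by (simp_all add: z_def)
        show ?thesis unfolding z(2) using f z(1) by (simp add: rep sc_sc L.rip_sc_sc T_L2)
      qed
      then show ?thesis using f by (intro L.eq_if_rip_eq) (simp_all add: T_L2)
    qed
  next
    fix f assume f: "f \<in> L2 ip"
    have "hnorm (l2ip ip) (T f) * hnorm (l2ip ip) (T f) \<le> \<bar>C\<bar> * hnorm (l2ip ip) f * hnorm (l2ip ip) (T f)"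
    proof -
      have "hnorm (l2ip ip) (T f) * hnorm (l2ip ip) (T f) = s f (T f)"
        using L.hnorm_power2[OF T_L2[OF f]] f by (simp add: rep T_L2 power2_eq_square)
      also have "\<dots> \<le> C * hnorm (l2ip ip) f * hnorm (l2ip ip) (T f)"
        using bound[OF f T_L2[OF f]] by simp
      also have "\<dots> \<le> \<bar>C\<bar> * hnorm (l2ip ip) f * hnorm (l2ip ip) (T f)"
        using L.hnorm_nonneg f T_L2 by (intro mult_right_mono) auto
      finally show ?thesis .
    qed
    then show "hnorm (l2ip ip) (T f) \<le> \<bar>C\<bar> * hnorm (l2ip ip) f"
      using L.hnorm_nonneg[OF T_L2[OF f]] L.hnorm_nonneg[OF f]
      by (cases "hnorm (l2ip ip) (T f) = 0") (auto simp: mult_le_cancel_right)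
  qed
  then show ?thesis using rep by blast
qed

section \<open>The bilateral shift and Toeplitz operators\<close>

lemma shift_L2: "f \<in> L2 ip \<Longrightarrow> shift f \<in> L2 ip"
  using summable_on_reindex_bij_betw[OF bij_pred_int, of "\<lambda>n. (hnorm ip (f n))\<^sup>2"]
  by (simp add: L2_def shift_def)

lemma shift_image: "shift ` L2 ip = L2 ip"
proof
  show "L2 ip \<subseteq> shift ` L2 ip"
  proof
    fix f assume f: "f \<in> L2 ip"
    have b: "bij (\<lambda>n::int. n + 1)" by (rule bij_plus_right)
    have "(\<lambda>n. f (n + 1)) \<in> L2 ip"
      using summable_on_reindex_bij_betw[OF b, of "\<lambda>n. (hnorm ip (f n))\<^sup>2"] f by (simp add: L2_def)
    moreover have "f = shift (\<lambda>n. f (n + 1))" by (simp add: shift_def)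
    ultimately show "f \<in> shift ` L2 ip" by blast
  qed
qed (auto simp: shift_L2)

lemma l2ip_shift: "l2ip ip (shift f) (shift g) = l2ip ip f g"
  using infsum_reindex_bij_betw[OF bij_pred_int, of "\<lambda>n. ip (f n) (g n)"]
  by (simp add: l2ip_def shift_def)

lemma hnorm_shift: "hnorm (l2ip ip) (shift f) = hnorm (l2ip ip) f"
  by (simp add: hnorm_def l2ip_shift)

lemma toeplitz_if_commutes:
  assumes "bounded_op sc ip T" "\<And>f. f \<in> L2 ip \<Longrightarrow> T (shift f) = shift (T f)"
  shows "toeplitz sc ip T"
  unfolding toeplitz_def shift_delta[symmetric]
  using assms delta_L2 by (simp add: shift_def)

text \<open>The matrix condition is commutation on sequences with one nonzero entry. Additivity
  extends it to finite truncations, and boundedness of T to their limits.\<close>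

lemma toeplitz_commutes:
  assumes T: "toeplitz sc ip T" and f: "f \<in> L2 ip"
  shows "T (shift f) = shift (T f)"
proof -
  have op: "bounded_op sc ip T" using T by (simp add: toeplitz_def)
  obtain C where C: "0 \<le> C" "\<And>f. f \<in> L2 ip \<Longrightarrow> hnorm (l2ip ip) (T f) \<le> C * hnorm (l2ip ip) f"
    using bounded_op_bound[OF op] by metis
  have T_L2: "\<And>f. f \<in> L2 ip \<Longrightarrow> T f \<in> L2 ip" using bounded_op_closed[OF op] .
  have delta: "T (shift (delta k x)) = shift (T (delta k x))" for k x
  proof
    fix j
    have "T (delta k x) (j - 1) = T (delta (k + 1) x) (j - 1 + 1)"
      using T unfolding toeplitz_def by blast
    then show "T (shift (delta k x)) j = shift (T (delta k x)) j"
      by (simp add: shift_delta) (simp add: shift_def)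
  qed
  have tr: "T (shift (trunc F f)) = shift (T (trunc F f))" if "finite F" for F
    using that
  proof (induction F)
    case empty
    have "shift 0 = (0 :: int \<Rightarrow> 'k)" by (simp add: shift_def fun_eq_iff)
    then show ?case by (simp only: trunc_empty bounded_op_zero[OF op])
  next
    case (insert k F)
    then show ?case
      by (simp add: trunc_insert shift_add bounded_op_add[OF op] delta_L2 trunc_L2_power2 shift_L2 delta
          del: plus_fun_apply)
  qed
  \<comment> \<open>The truncated part contributes nothing; the tail enters twice, as T after the
    shift and as the shift after T, and the shift is isometric.\<close>
  have le: "hnorm (l2ip ip) (T (shift f) - shift (T f)) \<le> 2 * C * hnorm (l2ip ip) (f - trunc F f)"
    if F: "finite F" for F
  proof -
    define g where "g = f - trunc F f"
    have t: "trunc F f \<in> L2 ip" and g: "g \<in> L2 ip" using f trunc_L2_power2[OF F] by (simp_all add: g_def)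
    have f_eq: "f = g + trunc F f" by (simp add: g_def)
    have "T (shift f) - shift (T f) = T (shift g) + - shift (T g)"
      by (subst (1 2) f_eq) (simp add: shift_add bounded_op_add[OF op] g t shift_L2 tr[OF F])
    then have "hnorm (l2ip ip) (T (shift f) - shift (T f))
        \<le> hnorm (l2ip ip) (T (shift g)) + hnorm (l2ip ip) (- shift (T g))"
      using L.hnorm_triangle[of "T (shift g)" "- shift (T g)"] g by (simp add: T_L2 shift_L2)
    also have "hnorm (l2ip ip) (- shift (T g)) = hnorm (l2ip ip) (T g)"
      using L.hnorm_sc[of "shift (T g)" "- 1"] g by (simp add: T_L2 shift_L2 L.sc_minus_one hnorm_shift)
    finally show ?thesis
      using C(2)[OF g] C(2)[OF shift_L2[OF g]] unfolding hnorm_shift g_def[symmetric] by linarith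
  qed
  have "((\<lambda>F. 2 * C * hnorm (l2ip ip) (f - trunc F f)) \<longlongrightarrow> 2 * C * 0) (finite_subsets_at_top UNIV)"
    by (intro tendsto_mult_left trunc_tendsto f)
  then have "hnorm (l2ip ip) (T (shift f) - shift (T f)) \<le> 2 * C * 0"
    by (rule tendsto_lowerbound)
      (auto intro!: eventually_finite_subsets_at_top_weakI le)
  then have "hnorm (l2ip ip) (T (shift f) - shift (T f)) = 0"
    using L.hnorm_nonneg[of "T (shift f) - shift (T f)"] f by (simp add: T_L2 shift_L2)
  then have "T (shift f) - shift (T f) = 0"
    using f by (intro L.hnorm_eq_zero) (simp_all add: T_L2 shift_L2)
  then show ?thesis by simp
qed

section \<open>Operators and their quadratic forms\<close>

definition op_form :: "((int \<Rightarrow> 'k) \<Rightarrow> int \<Rightarrow> 'k) \<Rightarrow> (int \<Rightarrow> 'k) \<Rightarrow> real" where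
  "op_form T x = L.rip (T x) x"

lemma rip_op_add_left:
  "bounded_op sc ip T \<Longrightarrow> x \<in> L2 ip \<Longrightarrow> x' \<in> L2 ip \<Longrightarrow> y \<in> L2 ip \<Longrightarrow>
    L.rip (T (x + x')) y = L.rip (T x) y + L.rip (T x') y"
  by (simp only: bounded_op_add L.rip_add_left bounded_op_closed)

lemma rip_op_diff_left:
  "bounded_op sc ip T \<Longrightarrow> x \<in> L2 ip \<Longrightarrow> x' \<in> L2 ip \<Longrightarrow> y \<in> L2 ip \<Longrightarrow>
    L.rip (T (x - x')) y = L.rip (T x) y - L.rip (T x') y"
  by (simp only: bounded_op_diff L.rip_diff_left bounded_op_closed)

lemma qform_op_form:
  assumes T: "bounded_op sc ip T"
  shows "L.qform (op_form T)"
  unfolding L.qform_def op_form_def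
proof (intro conjI ballI allI)
  fix x y assume x: "x \<in> L2 ip" and y: "y \<in> L2 ip"
  note cl = x y bounded_op_closed[OF T] L.add_closed L.diff_closed
  have "L.rip (T (x + y)) (x + y) = L.rip (T x) x + L.rip (T x) y + (L.rip (T y) x + L.rip (T y) y)"
    by (simp only: cl rip_op_add_left[OF T] L.rip_add_right)
  moreover have "L.rip (T (x - y)) (x - y) = L.rip (T x) x - L.rip (T x) y - (L.rip (T y) x - L.rip (T y) y)"
    by (simp only: cl rip_op_diff_left[OF T] L.rip_diff_right)
  ultimately show "L.rip (T (x + y)) (x + y) + L.rip (T (x - y)) (x - y)
      = 2 * L.rip (T x) x + 2 * L.rip (T y) y" by linarith
next
  fix c x assume x: "x \<in> L2 ip"
  show "L.rip (T (seq_scale sc c x)) (seq_scale sc c x) = (cmod c)\<^sup>2 * L.rip (T x) x"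
    using x by (simp only: bounded_op_scale[OF T] L.rip_sc_sc bounded_op_closed[OF T])
qed

lemma op_form_bound:
  assumes T: "bounded_op sc ip T"
  obtains C where "0 \<le> C" "\<forall>x\<in>L2 ip. op_form T x \<le> C * (hnorm (l2ip ip) x)\<^sup>2"
proof -
  obtain C where C: "0 \<le> C" "\<forall>f\<in>L2 ip. hnorm (l2ip ip) (T f) \<le> C * hnorm (l2ip ip) f"
    using bounded_op_bound[OF T] by metis
  have "op_form T x \<le> C * (hnorm (l2ip ip) x)\<^sup>2" if x: "x \<in> L2 ip" for x
  proof -
    have "op_form T x \<le> hnorm (l2ip ip) (T x) * hnorm (l2ip ip) x"
      using L.rip_Cauchy_Schwarz[OF bounded_op_closed[OF T x] x] by (simp add: op_form_def)
    also have "\<dots> \<le> C * hnorm (l2ip ip) x * hnorm (l2ip ip) x"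
      using C x L.hnorm_nonneg[OF x] by (intro mult_right_mono) auto
    finally show ?thesis by (simp add: power2_eq_square mult.assoc)
  qed
  then show ?thesis using that C by blast
qed

lemma op_form_shift:
  "toeplitz sc ip T \<Longrightarrow> x \<in> L2 ip \<Longrightarrow> op_form T (shift x) = op_form T x"
  by (simp add: op_form_def toeplitz_commutes L.rip_def l2ip_shift)

text \<open>The sesquilinear form \<open>d\<close> of the difference vanishes on the diagonal and is
  therefore antisymmetric. Replacing y by i y contradicts antisymmetry unless \<open>d\<close> is
  zero, so complex scalars are essential.\<close>

lemma bounded_op_eq_if_form_eq:
  assumes S: "bounded_op sc ip S" and T: "bounded_op sc ip T"
    and eq: "\<And>x. x \<in> L2 ip \<Longrightarrow> l2ip ip (S x) x = l2ip ip (T x) x" and x: "x \<in> L2 ip"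
  shows "S x = T x"
proof -
  define d where "d x y = l2ip ip (S x) y - l2ip ip (T x) y" for x y
  note cl = bounded_op_closed[OF S] bounded_op_closed[OF T] L.add_closed L.sc_closed
  have zero: "d x x = 0" if "x \<in> L2 ip" for x using eq[OF that] by (simp add: d_def)
  have anti: "d x y = - d y x" if xy: "x \<in> L2 ip" "y \<in> L2 ip" for x y
  proof -
    have "d (x + y) (x + y) = d x x + d x y + d y x + d y y"
      unfolding d_def
      by (simp only: xy cl bounded_op_add[OF S] bounded_op_add[OF T] L.ip_add_left L.ip_add_right)
        (simp only: diff_conv_add_uminus minus_add_distrib ac_simps)
    then show ?thesis using xy by (simp only: zero L.add_closed) (simp add: add_eq_0_iff)
  qed
  have "d x y = 0" if y: "y \<in> L2 ip" for y
  proof -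
    have "- \<i> * d x y = d x (seq_scale sc \<i> y)"
      using x y by (simp add: d_def L.ip_sc_right cl right_diff_distrib)
    also have "\<dots> = - d (seq_scale sc \<i> y) x" using x y by (intro anti) simp_all
    also have "\<dots> = - \<i> * d y x"
      using x y by (simp add: d_def L.ip_sc_left cl bounded_op_scale[OF S] bounded_op_scale[OF T] right_diff_distrib)
    also have "\<dots> = \<i> * d x y" by (subst anti[OF y x]) simp
    finally show ?thesis by simp
  qed
  then have "L.rip (S x) y = L.rip (T x) y" if "y \<in> L2 ip" for y
    using that by (simp add: d_def L.rip_def)
  then show ?thesis using x by (intro L.eq_if_rip_eq) (simp_all add: cl)
qed

text \<open>This leads back from forms to operators: the polar form is a bounded real form of the
  kind represented above, and invariance of \<open>q\<close> becomes commutation with the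
  shift.\<close>

lemma qform_representation:
  assumes q: "L.qform q" and nonneg: "\<forall>x\<in>L2 ip. 0 \<le> q x"
    and bound: "\<forall>x\<in>L2 ip. q x \<le> C * (hnorm (l2ip ip) x)\<^sup>2" and C: "0 \<le> C"
    and inv: "\<forall>x\<in>L2 ip. q (shift x) = q x"
  obtains T where "toeplitz sc ip T" "\<forall>x\<in>L2 ip. l2ip ip (T x) x = complex_of_real (q x)"
proof -
  have "\<exists>T. bounded_op sc ip T \<and> (\<forall>x\<in>L2 ip. \<forall>y\<in>L2 ip. L.rip (T x) y = L.polar q x y)"
    by (rule bounded_form_representation)
      (fact L.polar_add_left[OF q] L.polar_add_right[OF q] L.polar_real_right[OF q nonneg]
        L.polar_sc_sc[OF q] L.polar_bound[OF q nonneg bound C])+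
  then obtain T where T: "bounded_op sc ip T"
    and rep: "\<And>x y. x \<in> L2 ip \<Longrightarrow> y \<in> L2 ip \<Longrightarrow> L.rip (T x) y = L.polar q x y"
    by blast
  note cl = bounded_op_closed[OF T]
  have "l2ip ip (T x) x = complex_of_real (q x)" if x: "x \<in> L2 ip" for x
  proof -
    have "Re (l2ip ip (T x) x) = q x" using rep[OF x x] L.polar_self[OF q x] by (simp add: L.rip_def)
    moreover have "Im (l2ip ip (T x) x) = 0"
      using x L.polar_i[OF q x] by (simp add: L.Im_ip cl rep)
    ultimately show ?thesis by (simp add: complex_eq_iff)
  qed
  moreover have "toeplitz sc ip T"
  proof (rule toeplitz_if_commutes[OF T])
    fix f assume f: "f \<in> L2 ip"
    show "T (shift f) = shift (T f)"
    proof (rule L.eq_if_rip_eq)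
      fix y assume "y \<in> L2 ip"
      \<comment> \<open>As the shift is onto, it suffices to test against shifted vectors, for which
        both sides reduce to the polar form at f and z.\<close>
      then obtain z where z: "z \<in> L2 ip" "y = shift z" using shift_image by blast
      have sub: "shift f - shift z = shift (f - z)" by (simp add: shift_def fun_eq_iff)
      have "L.polar q (shift f) (shift z) = L.polar q f z"
        unfolding L.polar_def sub shift_add[symmetric] using f z(1) by (simp only: inv[THEN bspec] L.add_closed L.diff_closed)
      then show "L.rip (T (shift f)) y = L.rip (shift (T f)) y"
        unfolding z(2) using f z(1) by (simp add: rep shift_L2) (simp add: L.rip_def l2ip_shift flip: rep)
    qed (use f in \<open>simp_all add: shift_L2 cl\<close>)
  qed
  ultimately show ?thesis using that by blast
qed

text \<open>The choice in \<open>l2adj\<close> needs a witness, which is the operator representing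
  the real form \<open>L.rip x (B y)\<close>; testing also with i g recovers the complex
  identity.\<close>

lemma l2adj:
  assumes B: "bounded_op sc ip B"
  shows "bounded_op sc ip (l2adj sc ip B)"
    and "f \<in> L2 ip \<Longrightarrow> g \<in> L2 ip \<Longrightarrow> l2ip ip (B f) g = l2ip ip f (l2adj sc ip B g)"
proof -
  obtain C where C: "0 \<le> C" "\<forall>f\<in>L2 ip. hnorm (l2ip ip) (B f) \<le> C * hnorm (l2ip ip) f"
    using bounded_op_bound[OF B] by metis
  note cl = bounded_op_closed[OF B]
  have "\<exists>T. bounded_op sc ip T \<and> (\<forall>x\<in>L2 ip. \<forall>y\<in>L2 ip. L.rip (T x) y = L.rip x (B y))"
  proof (rule bounded_form_representation)
    fix x y assume x: "x \<in> L2 ip" and y: "y \<in> L2 ip"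
    have "\<bar>L.rip x (B y)\<bar> \<le> hnorm (l2ip ip) x * hnorm (l2ip ip) (B y)"
      by (rule L.rip_Cauchy_Schwarz[OF x cl[OF y]])
    also have "\<dots> \<le> hnorm (l2ip ip) x * (C * hnorm (l2ip ip) y)"
      using C y L.hnorm_nonneg[OF x] by (intro mult_left_mono) auto
    finally show "\<bar>L.rip x (B y)\<bar> \<le> C * hnorm (l2ip ip) x * hnorm (l2ip ip) y" by (simp add: ac_simps)
  qed (simp_all only: cl bounded_op_add[OF B] bounded_op_scale[OF B] L.rip_add_left L.rip_add_right
      L.rip_real_right L.rip_sc_sc)
  then obtain T where T: "bounded_op sc ip T"
    and rep: "\<And>x y. x \<in> L2 ip \<Longrightarrow> y \<in> L2 ip \<Longrightarrow> L.rip (T x) y = L.rip x (B y)" by blast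
  have "l2ip ip (B f) g = l2ip ip f (T g)" if f: "f \<in> L2 ip" and g: "g \<in> L2 ip" for f g
  proof (rule L.ip_eqI)
    have 1: "L.rip (B f) h = L.rip f (T h)" if h: "h \<in> L2 ip" for h
      using rep[OF h f] L.rip_commute[OF cl[OF f] h] L.rip_commute[OF f bounded_op_closed[OF T h]] by simp
    show "L.rip (B f) g = L.rip f (T g)" by (rule 1[OF g])
    show "L.rip (B f) (seq_scale sc \<i> g) = L.rip f (seq_scale sc \<i> (T g))"
      using 1[of "seq_scale sc \<i> g"] g by (simp add: bounded_op_scale[OF T])
  qed (use f g cl bounded_op_closed[OF T] in auto)
  then have "\<exists>T. bounded_op sc ip T \<and> (\<forall>f\<in>L2 ip. \<forall>g\<in>L2 ip. l2ip ip (B f) g = l2ip ip f (T g))"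
    using T by blast
  then have "bounded_op sc ip (l2adj sc ip B) \<and>
      (\<forall>f\<in>L2 ip. \<forall>g\<in>L2 ip. l2ip ip (B f) g = l2ip ip f (l2adj sc ip B g))"
    unfolding l2adj_def by (rule someI_ex)
  then show "bounded_op sc ip (l2adj sc ip B)"
    and "f \<in> L2 ip \<Longrightarrow> g \<in> L2 ip \<Longrightarrow> l2ip ip (B f) g = l2ip ip f (l2adj sc ip B g)" by auto
qed

text \<open>The off-diagonal contributions are complex conjugates: their real parts double and their
  imaginary parts cancel.\<close>

lemma block_form:
  assumes A: "bounded_op sc ip A" and M: "bounded_op sc ip M" and B: "bounded_op sc ip B"
    and x: "x \<in> L2 ip" and y: "y \<in> L2 ip"
  defines "w \<equiv> l2ip ip (\<lambda>n. A x n - M x n + l2adj sc ip B y n) x + l2ip ip (\<lambda>n. B x n + M y n) y"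
  shows "Re w = op_form A x - op_form M x + 2 * L.rip (B x) y + op_form M y"
    and "Im w = Im (l2ip ip (A x) x) - Im (l2ip ip (M x) x) + Im (l2ip ip (M y) y)"
proof -
  have cl: "A x \<in> L2 ip" "M x \<in> L2 ip" "B x \<in> L2 ip" "M y \<in> L2 ip" "l2adj sc ip B y \<in> L2 ip"
    using A M B l2adj(1)[OF B] x y by (simp_all add: bounded_op_closed)
  have "(\<lambda>n. A x n - M x n + l2adj sc ip B y n) = A x - M x + l2adj sc ip B y"
    "(\<lambda>n. B x n + M y n) = B x + M y" by (simp_all add: fun_eq_iff)
  moreover have "l2ip ip (A x - M x) x = l2ip ip (A x) x - l2ip ip (M x) x"
    using L.ip_add_left[of "A x - M x" "M x" x] cl x
    by (simp only: L.diff_closed diff_add_cancel eq_diff_eq)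
  moreover have "l2ip ip (l2adj sc ip B y) x = cnj (l2ip ip (B x) y)"
    using L.ip_cnj[OF x cl(5)] l2adj(2)[OF B x y] by simp
  ultimately have "w = l2ip ip (A x) x - l2ip ip (M x) x + cnj (l2ip ip (B x) y)
      + (l2ip ip (B x) y + l2ip ip (M y) y)"
    unfolding w_def using cl x y by (simp only: L.ip_add_left L.diff_closed)
  then show "Re w = op_form A x - op_form M x + 2 * L.rip (B x) y + op_form M y"
    and "Im w = Im (l2ip ip (A x) x) - Im (l2ip ip (M x) x) + Im (l2ip ip (M y) y)"
    by (simp_all add: op_form_def L.rip_def)
qed

text \<open>Splits membership into a self-adjointness condition on the imaginary parts and a real
  inequality, which is feasibility of \<open>op_form M\<close>.\<close>

lemma Mset_iff:
  assumes A: "bounded_op sc ip A" and B: "bounded_op sc ip B"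
  shows "M \<in> Mset sc ip A B \<longleftrightarrow> bounded_op sc ip M \<and>
    (\<forall>x\<in>L2 ip. Im (l2ip ip (A x) x) = 0 \<and> Im (l2ip ip (M x) x) = 0) \<and>
    (\<forall>x\<in>L2 ip. \<forall>y\<in>L2 ip. 0 \<le> op_form A x - op_form M x + 2 * L.rip (B x) y + op_form M y)"
    (is "?lhs \<longleftrightarrow> ?M \<and> ?im \<and> ?re")
proof (cases "bounded_op sc ip M")
  case M: True
  have iff: "?lhs \<longleftrightarrow> (\<forall>x\<in>L2 ip. \<forall>y\<in>L2 ip.
      Im (l2ip ip (A x) x) - Im (l2ip ip (M x) x) + Im (l2ip ip (M y) y) = 0) \<and> ?re"
    unfolding Mset_def block_psd_def mem_Collect_eq
    by (simp only: M simp_thms block_form[OF A M B] cong: ball_cong) blast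
  have im: "?im" if im: "\<forall>x\<in>L2 ip. \<forall>y\<in>L2 ip.
      Im (l2ip ip (A x) x) - Im (l2ip ip (M x) x) + Im (l2ip ip (M y) y) = 0"
  proof -
    \<comment> \<open>With first vector 0 only the contribution of M at y remains; once it vanishes,
      so does that of A.\<close>
    have z: "l2ip ip 0 0 = 0" using L.ip_sc_left[of 0 0 0] by simp
    have "Im (l2ip ip (M y) y) = 0" if y: "y \<in> L2 ip" for y
      using im[THEN bspec, THEN bspec, OF L.zero_closed y] z by (simp only: bounded_op_zero[OF A] bounded_op_zero[OF M])
    then show ?thesis using im by force
  qed
  show ?thesis
  proof
    assume ?lhs
    then show "?M \<and> ?im \<and> ?re" using M im iff by blast
  next
    assume "?M \<and> ?im \<and> ?re"
    then show ?lhs unfolding iff by simp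
  qed
qed (simp add: Mset_def)

end

section \<open>From the given operators to forms and back\<close>

lemma complex_hilbert_imp_hilbert_sequences:
  assumes "complex_hilbert sc ip"
  shows "hilbert_sequences sc ip"
proof -
  have ax: "\<forall>x. sc 1 x = x" "\<forall>a b x. sc a (sc b x) = sc (a * b) x"
    "\<forall>a b x. sc (a + b) x = sc a x + sc b x" "\<forall>a x y. sc a (x + y) = sc a x + sc a y"
    "\<forall>x y z. ip (x + y) z = ip x z + ip y z" "\<forall>a x y. ip (sc a x) y = a * ip x y"
    "\<forall>x y. ip y x = cnj (ip x y)" "\<forall>x. Im (ip x x) = 0 \<and> 0 \<le> Re (ip x x)"
    "\<forall>x. ip x x = 0 \<longrightarrow> x = 0"
    "\<forall>X. (\<forall>e>0. \<exists>N. \<forall>m\<ge>N. \<forall>n\<ge>N. hnorm ip (X m - X n) < e) \<longrightarrow>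
        (\<exists>l. (\<lambda>n. hnorm ip (X n - l)) \<longlonglongrightarrow> 0)"
    by (insert assms, unfold complex_hilbert_def) (elim conjE, assumption)+
  show ?thesis
    unfolding hilbert_sequences_def
  proof
    show "ip y x = cnj (ip x y)" for x y using ax(7) by blast
    show "\<exists>l\<in>UNIV. (\<lambda>n. hnorm ip (X n - l)) \<longlonglongrightarrow> 0"
      if "\<forall>e>0. \<exists>N. \<forall>m\<ge>N. \<forall>n\<ge>N. hnorm ip (X m - X n) < e" for X
      using ax(10) that by simp
  qed (use ax(1-6,8,9) in auto)
qed

theorem theorem4p5:
  fixes sc :: "complex \<Rightarrow> 'k::ab_group_add \<Rightarrow> 'k"
    and ip :: "'k \<Rightarrow> 'k \<Rightarrow> complex"
    and A B :: "(int \<Rightarrow> 'k) \<Rightarrow> (int \<Rightarrow> 'k)"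
  assumes "complex_hilbert sc ip"
    and "toeplitz sc ip A" and "toeplitz sc ip B"
    and "Mset sc ip A B \<noteq> {}"
  shows "\<exists>Ahat. toeplitz sc ip Ahat \<and> op_psd ip (\<lambda>x n. A x n - Ahat x n) \<and>
           (\<exists>Mhat. Mhat \<in> Mset sc ip Ahat B \<and>
              (\<forall>M\<in>Mset sc ip Ahat B. \<forall>x\<in>L2 ip. M x = Mhat x) \<and>
              toeplitz sc ip Mhat)"
proof -
  interpret hilbert_sequences sc ip
    using assms(1) by (rule complex_hilbert_imp_hilbert_sequences)
  have A: "bounded_op sc ip A" and B: "bounded_op sc ip B" using assms by (simp_all add: toeplitz_def)
  interpret C: coupling "L2 ip" "seq_scale sc" shift "\<lambda>x y. L.rip (B x) y"
  proof
    fix x y assume "x \<in> L2 ip" "y \<in> L2 ip"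
    then show "L.rip (B (shift x)) (shift y) = L.rip (B x) y"
      using toeplitz_commutes[OF assms(3)] by (simp add: L.rip_def l2ip_shift)
  qed (simp_all only: shift_image bounded_op_closed[OF B] rip_op_add_left[OF B] bounded_op_scale[OF B]
      L.rip_add_right L.rip_real_left L.rip_real_right L.rip_sc_sc)
  have feasible_op: "C.feasible q (op_form M)"
    if "bounded_op sc ip M"
      "\<forall>x\<in>L2 ip. \<forall>y\<in>L2 ip. 0 \<le> q x - op_form M x + 2 * L.rip (B x) y + op_form M y" for q M
    using that qform_op_form by (simp add: C.feasible_def)
  obtain M0 where "M0 \<in> Mset sc ip A B" using assms(4) by blast
  \<comment> \<open>Nonemptiness also yields that A has a real quadratic form, which the comparison
    of \<open>Ahat\<close> with A requires.\<close>
  then have M0: "bounded_op sc ip M0"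
    and imA: "\<And>x. x \<in> L2 ip \<Longrightarrow> Im (l2ip ip (A x) x) = 0"
    and re0: "\<forall>x\<in>L2 ip. \<forall>y\<in>L2 ip. 0 \<le> op_form A x - op_form M0 x + 2 * L.rip (B x) y + op_form M0 y"
    by (auto simp: Mset_iff[OF A B])
  have "C.inv_form (op_form A)"
    using qform_op_form[OF A] op_form_shift[OF assms(2)] by (simp add: C.inv_form_def)
  then obtain \<alpha> m where \<alpha>: "C.inv_form \<alpha>" "\<forall>x\<in>L2 ip. \<alpha> x \<le> op_form A x"
    and m: "C.inv_form m" "C.feasible \<alpha> m"
    and unique: "\<forall>m'. C.feasible \<alpha> m' \<longrightarrow> (\<forall>x\<in>L2 ip. m' x = m x)"
    by (rule C.exists_form_with_unique_feasible[OF _ feasible_op[OF M0 re0]])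
  have m_nonneg: "0 \<le> m x" and m_le: "m x \<le> \<alpha> x" if "x \<in> L2 ip" for x
    using C.feasible_nonneg[OF m(2) C.inv_form_imp_qform[OF \<alpha>(1)] that] C.feasible_le[OF m(2) that] by auto
  \<comment> \<open>One constant bounds both new forms, because \<open>m\<close> lies below
    \<open>\<alpha>\<close> and \<open>\<alpha>\<close> below the form of A.\<close>
  obtain c where c: "0 \<le> c" "\<forall>x\<in>L2 ip. op_form A x \<le> c * (hnorm (l2ip ip) x)\<^sup>2"
    by (rule op_form_bound[OF A])
  have \<alpha>_bound: "\<forall>x\<in>L2 ip. \<alpha> x \<le> c * (hnorm (l2ip ip) x)\<^sup>2"
    using \<alpha>(2) c(2) by (meson order_trans)
  have m_bound: "\<forall>x\<in>L2 ip. m x \<le> c * (hnorm (l2ip ip) x)\<^sup>2"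
    using m_le \<alpha>_bound by (meson order_trans)
  have nonneg: "\<forall>x\<in>L2 ip. 0 \<le> \<alpha> x" "\<forall>x\<in>L2 ip. 0 \<le> m x"
    using m_nonneg m_le by (meson order_trans)+
  have inv: "\<forall>x\<in>L2 ip. \<alpha> (shift x) = \<alpha> x" "\<forall>x\<in>L2 ip. m (shift x) = m x"
    using \<alpha>(1) m(1) by (simp_all add: C.inv_form_U)
  obtain Ahat where Ahat: "toeplitz sc ip Ahat" "\<forall>x\<in>L2 ip. l2ip ip (Ahat x) x = complex_of_real (\<alpha> x)"
    by (rule qform_representation[OF C.inv_form_imp_qform[OF \<alpha>(1)] nonneg(1) \<alpha>_bound c(1) inv(1)])
  obtain Mhat where Mhat: "toeplitz sc ip Mhat" "\<forall>x\<in>L2 ip. l2ip ip (Mhat x) x = complex_of_real (m x)"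
    by (rule qform_representation[OF C.inv_form_imp_qform[OF m(1)] nonneg(2) m_bound c(1) inv(2)])
  have Ah: "bounded_op sc ip Ahat" and Mh: "bounded_op sc ip Mhat"
    using Ahat Mhat by (simp_all add: toeplitz_def)
  have fA: "op_form Ahat x = \<alpha> x" and fM: "op_form Mhat x = m x" if "x \<in> L2 ip" for x
    using that Ahat(2) Mhat(2) by (simp_all add: op_form_def L.rip_def)
  have "op_psd ip (\<lambda>x n. A x n - Ahat x n)"
    unfolding op_psd_def
  proof
    fix x assume x: "x \<in> L2 ip"
    have "l2ip ip (\<lambda>n. A x n - Ahat x n) x = l2ip ip (A x - Ahat x) x"
      by (rule arg_cong[of _ _ "\<lambda>f. l2ip ip f x"]) (simp add: fun_eq_iff)
    also have "\<dots> = l2ip ip (A x) x - l2ip ip (Ahat x) x"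
      using L.ip_add_left[of "A x - Ahat x" "Ahat x" x] x bounded_op_closed[OF A x] bounded_op_closed[OF Ah x]
      by (simp only: L.diff_closed diff_add_cancel eq_diff_eq)
    finally show "Im (l2ip ip (\<lambda>n. A x n - Ahat x n) x) = 0 \<and> 0 \<le> Re (l2ip ip (\<lambda>n. A x n - Ahat x n) x)"
      using x imA[OF x] \<alpha>(2) Ahat(2) by (simp add: op_form_def L.rip_def)
  qed
  moreover have "Mhat \<in> Mset sc ip Ahat B"
    unfolding Mset_iff[OF Ah B]
    using Mh Ahat(2) Mhat(2) C.feasibleD[OF m(2)] by (simp add: fA fM)
  moreover have "M x = Mhat x" if M: "M \<in> Mset sc ip Ahat B" and x: "x \<in> L2 ip" for M x
  proof -
    have Mop: "bounded_op sc ip M" and im: "\<forall>x\<in>L2 ip. Im (l2ip ip (M x) x) = 0"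
      and re: "\<forall>x\<in>L2 ip. \<forall>y\<in>L2 ip. 0 \<le> \<alpha> x - op_form M x + 2 * L.rip (B x) y + op_form M y"
      using M unfolding Mset_iff[OF Ah B] by (auto simp: fA)
    \<comment> \<open>M is an arbitrary bounded operator here; uniqueness ranges over all feasible
      forms, invariant or not.\<close>
    have "\<forall>x\<in>L2 ip. op_form M x = m x" using unique feasible_op[OF Mop re] by blast
    then have "l2ip ip (M x) x = l2ip ip (Mhat x) x" if "x \<in> L2 ip" for x
      using that im Mhat(2) by (simp add: complex_eq_iff op_form_def L.rip_def)
    then show ?thesis by (rule bounded_op_eq_if_form_eq[OF Mop Mh _ x])
  qed
  ultimately show ?thesis using Ahat(1) Mhat(1) by blast
qed

end
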